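(* Let $n\ge 1$ and let $v$ be a non-zero element of $\mathbb{C}^{2n}$. Then the complex $2n$-dimensional vector space $$\mathcal{E}_v=\{\phi_a:\mathrm{Sp}(n,\mathbb{R})\to\mathbb{C}\mid \phi_a(x)=\operatorname{trace}(v^t a x^t),\ a\in\mathbb{C}^{2n}\}$$ is an eigenfamily on the semi-Riemannian Lie group $\mathrm{Sp}(n,\mathbb{R})$ such that for all $\phi,\psi\in\mathcal{E}_v$ we have $$\tau(\phi)=-\frac{2n+1}{2}\cdot\phi,\qquad\kappa(\phi,\psi)=-\frac12\cdot\phi\cdot\psi.$$
   Context: Elements of $\mathbb{C}^{2n}$ are row vectors, so $v^ta$ is the $2n\times 2n$ matrix $(v_ja_\alpha)_{j\alpha}$. Let $J_n=\begin{bmatrix}0&I_n\\-I_n&0\end{bmatrix}$. The real symplectic group is $\mathrm{Sp}(n,\mathbb{R})=\{x\in\mathrm{SL}_{2n}(\mathbb{R})\mid xJ_nx^t=J_n\}$ with Lie algebra $\mathfrak{sp}(n,\mathbb{R})=\{X\in\mathbb{R}^{2n\times 2n}\mid XJ_n+J_nX^t=0\}$; it carries the left-invariant semi-Riemannian metric $g$ determined by $g(Z,W)=-\operatorname{Re}\operatorname{trace}(ZW)$ on $\mathfrak{sp}(n,\mathbb{R})$. For smooth complex-valued functions $\phi,\psi$, $\tau(\phi)=\operatorname{div}(\nabla\phi)$ is the Laplace-Beltrami operator (tension field) and $\kappa(\phi,\psi)=g(\nabla\phi,\nabla\psi)$ is the conformality operator, where $g$ is extended complex-bilinearly to the complexified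 tangent bundle. A set $\mathcal{E}$ of complex-valued functions is an eigenfamily if there exist $\lambda,\mu\in\mathbb{C}$ with $\tau(\phi)=\lambda\phi$ and $\kappa(\phi,\psi)=\mu\phi\psi$ for all $\phi,\psi\in\mathcal{E}$. *)

theory Defs
  imports "HOL-Analysis.Analysis" "HOL-Library.Function_Algebras"
begin

section \<open>Calculus on an embedded submanifold of a Euclidean space\<close>

text \<open>
  A manifold is represented by its underlying set \<open>M\<close> in a Euclidean space. The definitions are
  meant for embedded submanifolds; a function on \<open>M\<close> is a function on the ambient space of which
  only the values on \<open>M\<close> matter.
\<close>

primrec Ck_on :: "nat \<Rightarrow> 'a::euclidean_space set \<Rightarrow> ('a \<Rightarrow> 'b::real_normed_vector) \<Rightarrow> bool" where
  "Ck_on 0 U f \<longleftrightarrow> continuous_on U f"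
| "Ck_on (Suc k) U f \<longleftrightarrow>
     (\<exists>f'. (\<forall>x\<in>U. (f has_derivative f' x) (at x)) \<and> (\<forall>v. Ck_on k U (\<lambda>x. f' x v)))"

definition smooth_on :: "'a::euclidean_space set \<Rightarrow> ('a \<Rightarrow> 'b::real_normed_vector) \<Rightarrow> bool" where
  "smooth_on M f \<longleftrightarrow>
     (\<forall>x\<in>M. \<exists>U F. open U \<and> x \<in> U \<and> (\<forall>k. Ck_on k U F) \<and> (\<forall>y\<in>M \<inter> U. f y = F y))"

definition tangent_space :: "'a::euclidean_space set \<Rightarrow> 'a \<Rightarrow> 'a set" where
  "tangent_space M x =
     {v. \<exists>\<gamma>. \<gamma> 0 = x \<and> (\<forall>t::real. \<gamma> t \<in> M) \<and> (\<gamma> has_vector_derivative v) (at 0)}"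

text \<open>
  The derivative \<open>df\<^sub>x(v)\<close> along a tangent vector \<open>v\<close>. The Frechet derivative within \<open>M\<close> is in
  general not unique as a linear map on the ambient space, but any two choices agree on
  \<^term>\<open>tangent_space M x\<close>, and \<open>tangent_deriv\<close> is only applied there.
\<close>

definition tangent_deriv ::
    "'a::euclidean_space set \<Rightarrow> ('a \<Rightarrow> 'b::real_normed_vector) \<Rightarrow> 'a \<Rightarrow> 'a \<Rightarrow> 'b" where
  "tangent_deriv M f x v = frechet_derivative f (at x within M) v"

definition vector_field_on :: "'a::euclidean_space set \<Rightarrow> ('a \<Rightarrow> 'a) \<Rightarrow> bool" where
  "vector_field_on M X \<longleftrightarrow> smooth_on M X \<and> (\<forall>x\<in>M. X x \<in> tangent_space M x)"

text \<open>
  The Lie bracket in ambient coordinates: its \<open>i\<close>-th component is \<open>X(Y\<^sub>i) - Y(X\<^sub>i)\<close>, i.e. the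
  commutator of the derivations \<open>X\<close> and \<open>Y\<close> applied to the \<open>i\<close>-th coordinate function.
\<close>

definition lie_bracket ::
    "'a::euclidean_space set \<Rightarrow> ('a \<Rightarrow> 'a) \<Rightarrow> ('a \<Rightarrow> 'a) \<Rightarrow> 'a \<Rightarrow> 'a" where
  "lie_bracket M X Y x = tangent_deriv M Y x (X x) - tangent_deriv M X x (Y x)"


section \<open>Levi-Civita connection, gradient and divergence\<close>

text \<open>
  A metric is a map \<open>g\<close>, where \<open>g x u v\<close> is the scalar product of \<open>u, v \<in> T\<^sub>xM\<close>. A connection is
  a map \<open>N\<close>, where \<open>N Y x v\<close> is the covariant derivative of \<open>Y\<close> in the direction \<open>v \<in> T\<^sub>xM\<close>.
\<close>

type_synonym 'a metric_tensor = "'a \<Rightarrow> 'a \<Rightarrow> 'a \<Rightarrow> real"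
type_synonym 'a connection = "('a \<Rightarrow> 'a) \<Rightarrow> 'a \<Rightarrow> 'a \<Rightarrow> 'a"

definition affine_connection :: "'a::euclidean_space set \<Rightarrow> 'a connection \<Rightarrow> bool" where
  "affine_connection M N \<longleftrightarrow>
     (\<forall>Y. vector_field_on M Y \<longrightarrow> (\<forall>x\<in>M. \<forall>v\<in>tangent_space M x. N Y x v \<in> tangent_space M x)) \<and>
     (\<forall>X Y. vector_field_on M X \<and> vector_field_on M Y \<longrightarrow> smooth_on M (\<lambda>x. N Y x (X x))) \<and>
     (\<forall>Y. vector_field_on M Y \<longrightarrow>
        (\<forall>x\<in>M. \<forall>u\<in>tangent_space M x. \<forall>v\<in>tangent_space M x. \<forall>a b.
           N Y x (a *\<^sub>R u + b *\<^sub>R v) = a *\<^sub>R N Y x u + b *\<^sub>R N Y x v)) \<and>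
     (\<forall>Y Z. vector_field_on M Y \<and> vector_field_on M Z \<longrightarrow>
        (\<forall>x\<in>M. \<forall>v\<in>tangent_space M x. N (\<lambda>y. Y y + Z y) x v = N Y x v + N Z x v)) \<and>
     (\<forall>f Y. smooth_on M f \<and> vector_field_on M Y \<longrightarrow>
        (\<forall>x\<in>M. \<forall>v\<in>tangent_space M x.
           N (\<lambda>y. f y *\<^sub>R Y y) x v = tangent_deriv M f x v *\<^sub>R Y x + f x *\<^sub>R N Y x v))"

definition metric_compatible :: "'a::euclidean_space set \<Rightarrow> 'a metric_tensor \<Rightarrow> 'a connection \<Rightarrow> bool" where
  "metric_compatible M g N \<longleftrightarrow>
     (\<forall>Y Z. vector_field_on M Y \<and> vector_field_on M Z \<longrightarrow>
        (\<forall>x\<in>M. \<forall>v\<in>tangent_space M x.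
           tangent_deriv M (\<lambda>y. g y (Y y) (Z y)) x v = g x (N Y x v) (Z x) + g x (Y x) (N Z x v)))"

definition torsion_free :: "'a::euclidean_space set \<Rightarrow> 'a connection \<Rightarrow> bool" where
  "torsion_free M N \<longleftrightarrow>
     (\<forall>X Y. vector_field_on M X \<and> vector_field_on M Y \<longrightarrow>
        (\<forall>x\<in>M. N Y x (X x) - N X x (Y x) = lie_bracket M X Y x))"

text \<open>
  On a semi-Riemannian manifold there is exactly one torsion-free metric connection; the choice
  operator is used because its values off \<open>M\<close>, and on functions that are not vector fields on
  \<open>M\<close>, are immaterial.
\<close>

definition levi_civita :: "'a::euclidean_space set \<Rightarrow> 'a metric_tensor \<Rightarrow> 'a connection" where
  "levi_civita M g = (SOME N. affine_connection M N \<and> metric_compatible M g N \<and> torsion_free M N)"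

definition trace_on :: "'a::euclidean_space set \<Rightarrow> ('a \<Rightarrow> 'a) \<Rightarrow> real" where
  "trace_on S L = (let B = (SOME B. independent B \<and> span B = S) in
     \<Sum>b\<in>B. representation B (L b) b)"

definition gradient :: "'a::euclidean_space set \<Rightarrow> 'a metric_tensor \<Rightarrow> ('a \<Rightarrow> real) \<Rightarrow> 'a \<Rightarrow> 'a" where
  "gradient M g f x =
     (THE w. w \<in> tangent_space M x \<and> (\<forall>v\<in>tangent_space M x. g x w v = tangent_deriv M f x v))"

definition divergence :: "'a::euclidean_space set \<Rightarrow> 'a metric_tensor \<Rightarrow> ('a \<Rightarrow> 'a) \<Rightarrow> 'a \<Rightarrow> real" where
  "divergence M g X x = trace_on (tangent_space M x) (\<lambda>v. levi_civita M g X x v)"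


section \<open>Tension field, conformality operator and eigenfamilies\<close>

text \<open>
  An element \<open>u + \<i> w\<close> of the complexified tangent space is represented by the pair \<open>(u, w)\<close>.
  Gradient and divergence are extended complex-linearly and the metric complex-bilinearly.
\<close>

definition cmetric :: "'a metric_tensor \<Rightarrow> 'a \<Rightarrow> 'a \<times> 'a \<Rightarrow> 'a \<times> 'a \<Rightarrow> complex" where
  "cmetric g x = (\<lambda>(u, w) (u', w').
     Complex (g x u u' - g x w w') (g x u w' + g x w u'))"

definition cgradient ::
    "'a::euclidean_space set \<Rightarrow> 'a metric_tensor \<Rightarrow> ('a \<Rightarrow> complex) \<Rightarrow> 'a \<Rightarrow> 'a \<times> 'a" where
  "cgradient M g \<phi> x = (gradient M g (\<lambda>y. Re (\<phi> y)) x, gradient M g (\<lambda>y. Im (\<phi> y)) x)"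

definition cdivergence ::
    "'a::euclidean_space set \<Rightarrow> 'a metric_tensor \<Rightarrow> ('a \<Rightarrow> 'a \<times> 'a) \<Rightarrow> 'a \<Rightarrow> complex" where
  "cdivergence M g Z x =
     Complex (divergence M g (\<lambda>y. fst (Z y)) x) (divergence M g (\<lambda>y. snd (Z y)) x)"

definition tension ::
    "'a::euclidean_space set \<Rightarrow> 'a metric_tensor \<Rightarrow> ('a \<Rightarrow> complex) \<Rightarrow> 'a \<Rightarrow> complex" where
  "tension M g \<phi> x = cdivergence M g (cgradient M g \<phi>) x"

definition conformality ::
    "'a::euclidean_space set \<Rightarrow> 'a metric_tensor \<Rightarrow> ('a \<Rightarrow> complex) \<Rightarrow> ('a \<Rightarrow> complex) \<Rightarrow> 'a \<Rightarrow> complex" where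
  "conformality M g \<phi> \<psi> x = cmetric g x (cgradient M g \<phi> x) (cgradient M g \<psi> x)"

definition eigenfamily :: "'a::euclidean_space set \<Rightarrow> 'a metric_tensor \<Rightarrow> ('a \<Rightarrow> complex) set \<Rightarrow> bool" where
  "eigenfamily M g E \<longleftrightarrow>
     (\<forall>\<phi>\<in>E. smooth_on M \<phi>) \<and>
     (\<exists>l m. \<forall>\<phi>\<in>E. \<forall>\<psi>\<in>E. \<forall>x\<in>M.
        tension M g \<phi> x = l * \<phi> x \<and> conformality M g \<phi> \<psi> x = m * \<phi> x * \<psi> x)"


section \<open>The real symplectic group\<close>

definition J_matrix :: "real^('n::finite + 'n)^('n + 'n)" where
  "J_matrix = (\<chi> i j. case (i, j) of
      (Inl a, Inr b) \<Rightarrow> if a = b then 1 else 0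
    | (Inr a, Inl b) \<Rightarrow> if a = b then -1 else 0
    | _ \<Rightarrow> 0)"

definition Sp :: "(real^('n::finite + 'n)^('n + 'n)) set" where
  "Sp = {x. det x = 1 \<and> x ** J_matrix ** transpose x = J_matrix}"

definition sp_algebra :: "(real^('n::finite + 'n)^('n + 'n)) set" where
  "sp_algebra = {X. X ** J_matrix + J_matrix ** transpose X = 0}"

definition left_invariant :: "(real^'m^'m \<Rightarrow> real^'m^'m \<Rightarrow> real) \<Rightarrow> (real^'m^'m) metric_tensor" where
  "left_invariant h x u w = h (matrix_inv x ** u) (matrix_inv x ** w)"

text \<open>
  For \<open>x\<close> in \<open>Sp\<close> and \<open>u\<close> tangent to \<open>Sp\<close> at \<open>x\<close>, the matrix \<open>x\<^sup>-\<^sup>1u\<close> lies in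
  \<^const>\<open>sp_algebra\<close> (see lemma \<open>tangent_space_Sp\<close> below); the trace is real here, so \<open>Re\<close> is omitted.
\<close>

definition sp_metric :: "(real^('n::finite + 'n)^('n + 'n)) metric_tensor" where
  "sp_metric = left_invariant (\<lambda>Z W. - trace (Z ** W))"

text \<open>
  \<open>\<phi>\<^sub>a(x) = trace (v\<^sup>t a x\<^sup>t)\<close>. A function on \<open>Sp\<close> is represented by its extension by zero, so that
  equality of functions is equality on \<open>Sp\<close>.
\<close>

definition phi ::
    "complex^('n::finite + 'n) \<Rightarrow> complex^('n + 'n) \<Rightarrow> real^('n + 'n)^('n + 'n) \<Rightarrow> complex" where
  "phi v a x = (if x \<in> Sp
     then trace ((\<chi> j \<alpha>. v $ j * a $ \<alpha>) ** transpose (map_matrix complex_of_real x))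
     else 0)"

definition E_family ::
    "complex^('n::finite + 'n) \<Rightarrow> (real^('n + 'n)^('n + 'n) \<Rightarrow> complex) set" where
  "E_family v = {phi v a | a. True}"

definition cfun_scale :: "complex \<Rightarrow> ('a \<Rightarrow> complex) \<Rightarrow> 'a \<Rightarrow> complex" where
  "cfun_scale c f = (\<lambda>x. c * f x)"

interpretation cfun: vector_space cfun_scale
  by unfold_locales (auto simp: cfun_scale_def fun_eq_iff algebra_simps)


section \<open>The tangent spaces of the symplectic group\<close>

lemma J_nth:
  "J_matrix $ Inl a $ Inl b = 0" "J_matrix $ Inr a $ Inr b = 0"
  "J_matrix $ Inl a $ Inr b = (if a = b then 1 else 0)"
  "J_matrix $ Inr a $ Inl b = (if a = b then -1 else 0)"
  by (simp_all add: J_matrix_def)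

lemma J_sq: "J_matrix ** J_matrix = - (mat 1 :: real^('n::finite + 'n)^('n + 'n))"
proof -
  have "(J_matrix ** J_matrix) $ i $ j = (- mat 1 :: real^('n + 'n)^('n + 'n)) $ i $ j" for i j
    by (cases i; cases j)
      (simp_all add: matrix_matrix_mult_def mat_def UNIV_Plus_UNIV[symmetric] sum.Plus J_nth
        if_distrib if_distribR eq_commute cong: if_cong del: UNIV_Plus_UNIV)
  then show ?thesis by (simp add: vec_eq_iff)
qed

lemma mm_bilinear: "bounded_bilinear ((**) :: real^'n^'m \<Rightarrow> real^'p^'n \<Rightarrow> real^'p^'m)"
  unfolding bilinear_conv_bounded_bilinear[symmetric] bilinear_def
  by (auto intro!: linearI simp: vec_eq_iff matrix_matrix_mult_def algebra_simps sum.distrib sum_distrib_left)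

lemma transpose_linear: "bounded_linear (transpose :: real^'n^'m \<Rightarrow> real^'m^'n)"
  unfolding linear_conv_bounded_linear[symmetric]
  by (auto intro!: linearI simp: vec_eq_iff transpose_def)

interpretation mm: bounded_bilinear "(**) :: real^'n^'m \<Rightarrow> real^'p^'n \<Rightarrow> real^'p^'m"
  by (rule mm_bilinear)

lemmas tr_add = bounded_linear.linear[OF transpose_linear, THEN linear_add]
  and tr_diff = bounded_linear.linear[OF transpose_linear, THEN linear_diff]
  and tr_scaleR = bounded_linear.linear[OF transpose_linear, THEN linear_cmul]

lemma det_J: "det (J_matrix :: real^('n::finite + 'n)^('n + 'n)) \<noteq> 0"
proof
  assume "det (J_matrix :: real^('n + 'n)^('n + 'n)) = 0"
  then have "det (- mat 1 :: real^('n + 'n)^('n + 'n)) = 0"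
    by (metis J_sq det_mul mult_zero_left)
  moreover have "(- mat 1 :: real^('n + 'n)^('n + 'n)) ** (- mat 1) = mat 1"
    by (simp add: mm.minus_left mm.minus_right)
  ultimately show False by (metis det_I det_mul mult_zero_left zero_neq_one)
qed

lemma Sp_inv:
  assumes "x \<in> Sp" shows "invertible x" "matrix_inv x ** x = mat 1" "x ** matrix_inv x = mat 1"
proof -
  show i: "invertible x" using assms by (simp add: Sp_def invertible_det_nz)
  then obtain y where "x ** y = mat 1 \<and> y ** x = mat 1" by (auto simp: invertible_def)
  then have "x ** matrix_inv x = mat 1 \<and> matrix_inv x ** x = mat 1"
    unfolding matrix_inv_def by (rule someI)
  then show "matrix_inv x ** x = mat 1" "x ** matrix_inv x = mat 1" by auto
qed

lemma continuous_det:
  fixes A :: "real \<Rightarrow> real^'m::finite^'m"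
  assumes "\<And>i j. isCont (\<lambda>t. A t $ i $ j) 0"
  shows "isCont (\<lambda>t. det (A t)) 0"
  unfolding det_def by (intro continuous_intros assms)

lemma cayley_deriv:
  fixes Z :: "real^'m::finite^'m"
  defines "A \<equiv> (\<lambda>t. mat 1 - t *\<^sub>R Z)"
  obtains C where "isCont C 0" "C 0 = mat 1" "\<forall>\<^sub>F t in nhds 0. A t ** C t = mat 1 \<and> det (A t) \<noteq> 0"
proof -
  define C :: "real \<Rightarrow> real^'m^'m" where
    "C t = (\<chi> k l. det (\<chi> i j. if j = k then mat 1 $ i $ l else A t $ i $ j) / det (A t))" for t
  have cA: "isCont (\<lambda>t. A t $ i $ j) 0" for i j unfolding A_def by (simp add: mat_def)
  have dA: "isCont (\<lambda>t. det (A t)) 0" by (rule continuous_det[OF cA])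
  have A0: "A 0 = mat 1" by (simp add: A_def)
  have "\<forall>\<^sub>F t in at 0. det (A t) \<noteq> 0"
    using dA A0 tendsto_imp_eventually_ne[of "\<lambda>t. det (A t)" 1 "at 0" 0] by (simp add: isCont_def)
  then have ev: "\<forall>\<^sub>F t in nhds 0. det (A t) \<noteq> 0"
    by (simp add: eventually_nhds_conv_at A0)
  have AC: "A t ** C t = mat 1" if "det (A t) \<noteq> 0" for t
  proof -
    have "A t *v (\<chi> k. C t $ k $ l) = (\<chi> i. mat 1 $ i $ l)" for l
      by (subst cramer[OF that]) (simp add: C_def cong: if_cong)
    then show ?thesis by (simp add: vec_eq_iff matrix_vector_mult_def matrix_matrix_mult_def)
  qed
  have "C 0 = mat 1" using AC[of 0] A0 by simp
  moreover have "isCont C 0"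
  proof -
    have "isCont (\<lambda>t. C t $ k $ l) 0" for k l
    proof -
      have "isCont (\<lambda>t. (\<chi> i j. if j = k then mat 1 $ i $ l else A t $ i $ j) $ i' $ j') 0" for i' j'
        using cA by (cases "j' = k") simp_all
      then have "isCont (\<lambda>t. det (\<chi> i j. if j = k then mat 1 $ i $ l else A t $ i $ j)) 0"
        by (rule continuous_det)
      then show ?thesis unfolding C_def by (simp add: isCont_divide dA A0)
    qed
    then have "isCont (\<lambda>t. \<chi> k l. C t $ k $ l) 0"
      unfolding isCont_def by (auto intro!: vec_tendstoI)
    then show ?thesis by simp
  qed
  ultimately show ?thesis using that[of C] AC eventually_mono[OF ev] by simp
qed

lemma tangent_space_Sp:
  fixes x :: "real^('n::finite + 'n)^('n + 'n)"
  assumes x: "x \<in> Sp"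
  shows "tangent_space Sp x = (\<lambda>Z. x ** Z) ` sp_algebra"
proof (intro set_eqI iffI)
  let ?J = "J_matrix :: real^('n + 'n)^('n + 'n)"
  fix v assume "v \<in> tangent_space Sp x"
  then obtain \<gamma> where g: "\<gamma> 0 = x" "\<And>t::real. \<gamma> t \<in> Sp" "(\<gamma> has_vector_derivative v) (at 0)"
    by (auto simp: tangent_space_def)
  define Z where "Z = matrix_inv x ** v"
  have v: "v = x ** Z" unfolding Z_def by (simp add: matrix_mul_assoc Sp_inv[OF x])
  have "((\<lambda>t. (\<gamma> t ** ?J) ** transpose (\<gamma> t)) has_vector_derivative
      (\<gamma> 0 ** ?J) ** transpose v + (v ** ?J) ** transpose (\<gamma> 0)) (at 0)"
    by (rule mm.has_vector_derivative[OF
      bounded_linear.has_vector_derivative[OF mm.bounded_linear_left g(3)] bounded_linear.has_vector_derivative[OF transpose_linear g(3)]])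
  moreover have "(\<lambda>t. (\<gamma> t ** ?J) ** transpose (\<gamma> t)) = (\<lambda>t. ?J)"
    using g(2) by (simp add: Sp_def)
  ultimately have "x ** ?J ** transpose v + v ** ?J ** transpose x = 0"
    using g(1) vector_derivative_unique_at[OF _ has_vector_derivative_const[of ?J "at 0"]] by simp
  then have "x ** (?J ** transpose Z + Z ** ?J) ** transpose x = 0"
    by (simp add: v matrix_transpose_mul matrix_mul_assoc mm.add_left mm.add_right)
  then have "matrix_inv x ** (x ** (?J ** transpose Z + Z ** ?J) ** transpose x) ** transpose (matrix_inv x) = 0"
    by (simp add: mm.zero_left mm.zero_right)
  moreover have "matrix_inv x ** (x ** W ** transpose x) ** transpose (matrix_inv x) = W" for W
  proof -
    have "matrix_inv x ** (x ** W ** transpose x) ** transpose (matrix_inv x) =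
      (matrix_inv x ** x) ** W ** transpose (matrix_inv x ** x)"
      by (simp add: matrix_transpose_mul matrix_mul_assoc)
    then show ?thesis by (simp add: Sp_inv[OF x] transpose_mat)
  qed
  ultimately show "v \<in> (\<lambda>Z. x ** Z) ` sp_algebra"
    using v by (auto simp: sp_algebra_def add.commute)
next
  let ?J = "J_matrix :: real^('n + 'n)^('n + 'n)"
  fix v assume "v \<in> (\<lambda>Z. x ** Z) ` sp_algebra"
  then obtain Z where Z: "Z ** ?J + ?J ** transpose Z = 0" and v: "v = x ** Z"
    by (auto simp: sp_algebra_def)
  have ZJ: "?J ** transpose Z = - (Z ** ?J)" using Z by (simp add: eq_neg_iff_add_eq_0 add.commute)
  define Y where "Y = (1/2) *\<^sub>R Z"
  have YJ: "?J ** transpose Y = - (Y ** ?J)"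
    unfolding Y_def by (simp add: ZJ tr_scaleR mm.scaleR_left mm.scaleR_right)
  define A where "A = (\<lambda>t. mat 1 - t *\<^sub>R Y)"
  define B where "B = (\<lambda>t. mat 1 + t *\<^sub>R Y)"
  obtain C where C: "isCont C 0" "C 0 = mat 1"
      "\<forall>\<^sub>F t in nhds 0. A t ** C t = mat 1 \<and> det (A t) \<noteq> 0"
    unfolding A_def by (rule cayley_deriv[of Y])
  have BA: "B t - A t = t *\<^sub>R Z" for t
    by (simp add: A_def B_def Y_def vec_eq_iff)
  have JA: "?J ** transpose (A t) = B t ** ?J" and JB: "?J ** transpose (B t) = A t ** ?J" for t
    unfolding A_def B_def
    by (simp_all add: tr_add tr_diff tr_scaleR mm.scaleR_left mm.scaleR_right mm.add_left mm.add_right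
        mm.diff_left mm.diff_right YJ transpose_mat)
  have dAB: "det (A t) = det (B t)" for t
  proof -
    have "det ?J * det (A t) = det (B t) * det ?J"
      by (metis JA det_mul det_transpose)
    then show ?thesis using det_J[where 'n='n] by simp
  qed
  have AB: "A t ** B t = B t ** A t" for t
    unfolding A_def B_def
    by (simp add: mm.scaleR_left mm.scaleR_right mm.add_left mm.add_right mm.diff_left mm.diff_right algebra_simps)
  define \<gamma> where "\<gamma> = (\<lambda>t. if A t ** C t = mat 1 \<and> det (A t) \<noteq> 0 then x ** (C t ** B t) else x)"
  have "\<gamma> t \<in> Sp" for t
  proof (cases "A t ** C t = mat 1 \<and> det (A t) \<noteq> 0")
    case True
    then have AC: "A t ** C t = mat 1" and CA: "C t ** A t = mat 1" and nz: "det (A t) \<noteq> 0"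
      by (auto simp: matrix_left_right_inverse)
    have "det (A t) * det (C t) = 1" using AC by (metis det_I det_mul)
    then have d: "det (C t ** B t) = 1" using dAB by (simp add: det_mul mult.commute)
    have "C t ** B t ** ?J ** transpose (C t ** B t) = C t ** B t ** (?J ** transpose (B t)) ** transpose (C t)"
      by (simp add: matrix_transpose_mul matrix_mul_assoc)
    also have "\<dots> = C t ** (B t ** A t) ** ?J ** transpose (C t)"
      by (simp add: JB matrix_mul_assoc)
    also have "\<dots> = (C t ** A t) ** (B t ** ?J) ** transpose (C t)"
      by (simp add: AB[symmetric] matrix_mul_assoc)
    also have "\<dots> = ?J ** (transpose (A t) ** transpose (C t))"
      by (simp add: CA JA[symmetric] matrix_mul_assoc)
    also have "\<dots> = ?J ** transpose (C t ** A t)"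
      by (simp only: matrix_transpose_mul)
    finally have e: "C t ** B t ** ?J ** transpose (C t ** B t) = ?J" by (simp add: CA transpose_mat)
    have "x ** (C t ** B t) ** ?J ** transpose (x ** (C t ** B t)) =
        x ** (C t ** B t ** ?J ** transpose (C t ** B t)) ** transpose x"
      by (simp add: matrix_transpose_mul matrix_mul_assoc)
    then show ?thesis using x True d by (simp add: \<gamma>_def Sp_def e det_mul)
  qed (use x in \<open>auto simp: \<gamma>_def\<close>)
  moreover have "\<gamma> 0 = x" by (simp add: \<gamma>_def C B_def)
  moreover have "(\<gamma> has_vector_derivative v) (at 0)"
  proof -
    have ev: "\<forall>\<^sub>F t in nhds 0. \<gamma> t = x + t *\<^sub>R (x ** (C t ** Z))"
      using C(3)
    proof eventually_elim
      case (elim t)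
      then have CA: "C t ** A t = mat 1" by (auto simp: matrix_left_right_inverse)
      have "C t ** B t = C t ** A t + C t ** (B t - A t)" by (simp add: mm.diff_right)
      then have "C t ** B t = mat 1 + t *\<^sub>R (C t ** Z)"
        by (simp add: CA BA mm.scaleR_right)
      then show ?case using elim by (simp add: \<gamma>_def mm.add_right mm.scaleR_right)
    qed
    moreover have "((\<lambda>t. x + t *\<^sub>R (x ** (C t ** Z))) has_vector_derivative v) (at 0)"
    proof -
      have "((\<lambda>t. x ** (C t ** Z)) \<longlongrightarrow> x ** (mat 1 ** Z)) (at 0)"
        using C(1,2) by (intro mm.tendsto tendsto_const) (simp add: isCont_def)
      then have "((\<lambda>t. norm (x ** (C t ** Z) - v)) \<longlongrightarrow> 0) (at 0)"
        by (simp add: v LIM_zero tendsto_norm_zero)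
      moreover have "\<forall>\<^sub>F t in at 0. norm (x ** (C t ** Z) - v) =
          norm (x + t *\<^sub>R (x ** (C t ** Z)) - x - t *\<^sub>R v) / norm t"
        by (auto simp: eventually_at_filter scaleR_diff_right[symmetric])
      ultimately have "((\<lambda>t. norm (x + t *\<^sub>R (x ** (C t ** Z)) - x - t *\<^sub>R v) / norm t) \<longlongrightarrow> 0) (at 0)"
        by (rule Lim_transform_eventually)
      then show ?thesis
        unfolding has_vector_derivative_def has_derivative_at
        by (simp add: bounded_linear_scaleR_left)
    qed
    moreover obtain S where "open S" "0 \<in> S" "\<And>t. t \<in> S \<Longrightarrow> \<gamma> t = x + t *\<^sub>R (x ** (C t ** Z))"
      using ev unfolding eventually_nhds by blast
    ultimately show ?thesis
      by (metis (no_types, lifting) has_vector_derivative_transform_within_open)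
  qed
  ultimately show "v \<in> tangent_space Sp x" by (auto simp: tangent_space_def)
qed

end

theory Submission
  imports Defs
begin

text \<open>
  The trace form makes \<open>Sp\<close> a bi-invariant semi-Riemannian group, so its Levi-Civita connection is
  \<open>\<nabla>\<^sub>v Y = dY(v) - (v x\<^sup>-\<^sup>1 Y + Y x\<^sup>-\<^sup>1 v) / 2\<close> in ambient matrix coordinates. Real and imaginary part of
  \<open>\<phi>\<^sub>a\<close> are restrictions of \<open>x \<mapsto> trace (R x)\<close>, where \<open>R\<close> is the real or imaginary part of \<open>a\<^sup>t v\<close>; such
  a function has the gradient \<open>- (x R x + J R\<^sup>t J) / 2\<close>. In \<open>\<kappa>\<close> the \<open>J\<close>-terms recombine to a multiple
  of \<open>v J v\<^sup>t = 0\<close>. For \<open>\<tau>\<close>, the covariant derivative of the gradient is, after translation to the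
  identity, \<open>A \<mapsto> - (A Q + Q A) / 2\<close> with \<open>trace Q = trace (R x)\<close>; its trace is computed in the
  overcomplete frame of projections of the elementary matrices to the Lie algebra.
\<close>

section \<open>Smooth functions\<close>

lemma Ck_on_cong:
  assumes "open U" "\<And>x. x \<in> U \<Longrightarrow> f x = g x" "Ck_on k U f"
  shows "Ck_on k U g"
  using assms(2,3)
proof (induction k arbitrary: f g)
  case 0
  then show ?case by (metis Ck_on.simps(1) continuous_on_cong)
next
  case (Suc k)
  then obtain f' where f': "\<forall>x\<in>U. (f has_derivative f' x) (at x)" "\<forall>v. Ck_on k U (\<lambda>x. f' x v)"
    by auto
  have "(g has_derivative f' x) (at x)" if "x \<in> U" for x
    using has_derivative_transform_within_open[of f "f' x" x UNIV U g] f'(1) that assms(1) Suc.prems(1) by auto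
  with f' show ?case by auto
qed

lemma Ck_on_subset: "Ck_on k U f \<Longrightarrow> V \<subseteq> U \<Longrightarrow> Ck_on k V f"
proof (induction k arbitrary: f)
  case 0
  then show ?case by (auto intro: continuous_on_subset)
next
  case (Suc k)
  then obtain f' where "\<forall>x\<in>U. (f has_derivative f' x) (at x)" "\<forall>v. Ck_on k U (\<lambda>x. f' x v)"
    by auto
  with Suc show ?case by (auto intro!: exI[of _ f'])
qed

text \<open>The product rule expresses a derivative through the factors themselves, so the induction
  for products has to lower the class of a factor by one. The base case is continuity of
  differentiable functions.\<close>

lemma Ck_on_SucD: "Ck_on (Suc k) U f \<Longrightarrow> Ck_on k U f"
proof (induction k arbitrary: f)
  case 0
  then show ?case
    using has_derivative_at_withinI by (fastforce intro: has_derivative_continuous_on)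
next
  case (Suc k)
  then obtain f' where f': "\<forall>x\<in>U. (f has_derivative f' x) (at x)" "\<forall>v. Ck_on (Suc k) U (\<lambda>x. f' x v)"
    by (auto simp only: Ck_on.simps(2)[of "Suc k"])
  then show ?case using Suc.IH by (subst Ck_on.simps(2)) blast
qed

lemma Ck_on_const: "Ck_on k U (\<lambda>x. c)"
  by (induction k arbitrary: c) (auto intro!: exI[of _ "\<lambda>x v. 0"])

lemma Ck_on_bounded_linear: "bounded_linear h \<Longrightarrow> Ck_on k U h"
  by (cases k) (auto intro!: exI[of _ "\<lambda>x. h"] Ck_on_const bounded_linear_imp_has_derivative
      intro: linear_continuous_on)

lemma Ck_on_add: "Ck_on k U f \<Longrightarrow> Ck_on k U g \<Longrightarrow> Ck_on k U (\<lambda>x. f x + g x)"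
proof (induction k arbitrary: f g)
  case 0
  then show ?case by (auto intro: continuous_on_add)
next
  case (Suc k)
  then obtain f' g' where
      "\<forall>x\<in>U. (f has_derivative f' x) (at x)" "\<forall>v. Ck_on k U (\<lambda>x. f' x v)"
      "\<forall>x\<in>U. (g has_derivative g' x) (at x)" "\<forall>v. Ck_on k U (\<lambda>x. g' x v)"
    by (auto simp only: Ck_on.simps(2))
  then show ?case using Suc.IH
    by (auto intro!: exI[of _ "\<lambda>x v. f' x v + g' x v"] has_derivative_add)
qed

text \<open>Leibniz rule: the derivative is a sum of two terms of the same bilinear shape, with one
  factor differentiated in each. Hence the induction runs over all pairs \<open>f\<close>,
  \<open>g\<close> at once.\<close>

lemma Ck_on_bilinear:
  assumes "bounded_bilinear h"
  shows "Ck_on k U f \<Longrightarrow> Ck_on k U g \<Longrightarrow> Ck_on k U (\<lambda>x. h (f x) (g x))"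
proof (induction k arbitrary: f g)
  case 0
  then show ?case by (auto intro: bounded_bilinear.continuous_on[OF assms])
next
  case (Suc k)
  then obtain f' g' where d:
      "\<forall>x\<in>U. (f has_derivative f' x) (at x)" "\<forall>v. Ck_on k U (\<lambda>x. f' x v)"
      "\<forall>x\<in>U. (g has_derivative g' x) (at x)" "\<forall>v. Ck_on k U (\<lambda>x. g' x v)"
    by (auto simp only: Ck_on.simps(2))
  have "Ck_on k U f" "Ck_on k U g" by (rule Suc.prems[THEN Ck_on_SucD])+
  then have "Ck_on k U (\<lambda>x. h (f x) (g' x v) + h (f' x v) (g x))" for v
    using d Suc.IH by (auto intro!: Ck_on_add)
  with d show ?case
    by (auto intro!: exI[of _ "\<lambda>x v. h (f x) (g' x v) + h (f' x v) (g x)"]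
        bounded_bilinear.FDERIV[OF assms])
qed

lemma Ck_on_linear_compose:
  assumes "bounded_linear h"
  shows "Ck_on k U f \<Longrightarrow> Ck_on k U (\<lambda>x. h (f x))"
proof (induction k arbitrary: f)
  case 0
  then show ?case by (auto intro: bounded_linear.continuous_on[OF assms])
next
  case (Suc k)
  then obtain f' where d:
      "\<forall>x\<in>U. (f has_derivative f' x) (at x)" "\<forall>v. Ck_on k U (\<lambda>x. f' x v)"
    by (auto simp only: Ck_on.simps(2))
  with Suc.IH show ?case
    by (auto intro!: exI[of _ "\<lambda>x v. h (f' x v)"] bounded_linear.has_derivative[OF assms])
qed

lemma Ck_on_sum: "(\<And>i. i \<in> I \<Longrightarrow> Ck_on k U (f i)) \<Longrightarrow> Ck_on k U (\<lambda>x. \<Sum>i\<in>I. f i x)"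
  by (induction I rule: infinite_finite_induct) (simp_all add: Ck_on_const Ck_on_add)

text \<open>\<open>Ck_on\<close> hides the derivative behind an existential that may yield a
  different witness for each \<open>k\<close>. Uniqueness of the derivative replaces all of them by
  one fixed function.\<close>

lemma Ck_on_frechet_derivative:
  assumes "open U" "Ck_on (Suc k) U f"
  shows "Ck_on k U (\<lambda>x. frechet_derivative f (at x) v)"
proof -
  obtain f' where d:
      "\<forall>x\<in>U. (f has_derivative f' x) (at x)" "\<forall>v. Ck_on k U (\<lambda>x. f' x v)"
    using assms by (auto simp only: Ck_on.simps(2))
  then have "f' x v = frechet_derivative f (at x) v" if "x \<in> U" for x
    using that frechet_derivative_at by metis
  then show ?thesis
    using Ck_on_cong[OF assms(1), of "\<lambda>x. f' x v"] d(2) by simp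
qed

lemma smooth_onE:
  assumes "smooth_on M f" "x \<in> M"
  obtains U F where "open U" "x \<in> U" "\<And>k. Ck_on k U F" "\<And>y. y \<in> M \<Longrightarrow> y \<in> U \<Longrightarrow> f y = F y"
proof -
  obtain U F where "open U" "x \<in> U" "\<forall>k. Ck_on k U F" "\<forall>y\<in>M \<inter> U. f y = F y"
    using assms unfolding smooth_on_def by blast
  then show ?thesis by (intro that[of U F]) auto
qed

lemma smooth_on_cong: "(\<And>x. x \<in> M \<Longrightarrow> f x = g x) \<Longrightarrow> smooth_on M f \<longleftrightarrow> smooth_on M g"
  unfolding smooth_on_def by (intro ball_cong refl ex_cong1) auto

lemma smooth_on_const: "smooth_on M (\<lambda>x. c)"
  unfolding smooth_on_def by (auto intro!: exI[of _ UNIV] exI[of _ "\<lambda>x. c"] Ck_on_const)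

lemma smooth_on_bounded_linear: "bounded_linear h \<Longrightarrow> smooth_on M h"
  unfolding smooth_on_def by (auto intro!: exI[of _ UNIV] exI[of _ h] Ck_on_bounded_linear)

lemma smooth_on_bilinear:
  assumes "bounded_bilinear h" "smooth_on M f" "smooth_on M g"
  shows "smooth_on M (\<lambda>x. h (f x) (g x))"
  unfolding smooth_on_def
proof
  fix x assume x: "x \<in> M"
  obtain U F where U: "open U" "x \<in> U" "\<And>k. Ck_on k U F" "\<And>y. y \<in> M \<Longrightarrow> y \<in> U \<Longrightarrow> f y = F y"
    using assms(2) x by (rule smooth_onE) auto
  obtain V G where V: "open V" "x \<in> V" "\<And>k. Ck_on k V G" "\<And>y. y \<in> M \<Longrightarrow> y \<in> V \<Longrightarrow> g y = G y"
    using assms(3) x by (rule smooth_onE) auto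
  show "\<exists>U F. open U \<and> x \<in> U \<and> (\<forall>k. Ck_on k U F) \<and> (\<forall>y\<in>M \<inter> U. h (f y) (g y) = F y)"
    using U V Ck_on_subset[OF U(3), of "U \<inter> V"] Ck_on_subset[OF V(3), of "U \<inter> V"]
    by (intro exI[of _ "U \<inter> V"] exI[of _ "\<lambda>x. h (F x) (G x)"]) (auto intro: Ck_on_bilinear[OF assms(1)])
qed

lemma smooth_on_add:
  assumes "smooth_on M f" "smooth_on M g"
  shows "smooth_on M (\<lambda>x. f x + g x)"
  unfolding smooth_on_def
proof
  fix x assume x: "x \<in> M"
  obtain U F where U: "open U" "x \<in> U" "\<And>k. Ck_on k U F" "\<And>y. y \<in> M \<Longrightarrow> y \<in> U \<Longrightarrow> f y = F y"
    using assms(1) x by (rule smooth_onE) auto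
  obtain V G where V: "open V" "x \<in> V" "\<And>k. Ck_on k V G" "\<And>y. y \<in> M \<Longrightarrow> y \<in> V \<Longrightarrow> g y = G y"
    using assms(2) x by (rule smooth_onE) auto
  show "\<exists>U F. open U \<and> x \<in> U \<and> (\<forall>k. Ck_on k U F) \<and> (\<forall>y\<in>M \<inter> U. f y + g y = F y)"
    using U V Ck_on_subset[OF U(3), of "U \<inter> V"] Ck_on_subset[OF V(3), of "U \<inter> V"]
    by (intro exI[of _ "U \<inter> V"] exI[of _ "\<lambda>x. F x + G x"]) (auto intro: Ck_on_add)
qed

lemma smooth_on_linear_compose:
  assumes "bounded_linear h" "smooth_on M f"
  shows "smooth_on M (\<lambda>x. h (f x))"
  unfolding smooth_on_def
proof
  fix x assume "x \<in> M"
  then obtain U F where "open U" "x \<in> U" "\<And>k. Ck_on k U F" "\<And>y. y \<in> M \<Longrightarrow> y \<in> U \<Longrightarrow> f y = F y"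
    using assms(2) by (metis smooth_onE)
  then show "\<exists>U F. open U \<and> x \<in> U \<and> (\<forall>k. Ck_on k U F) \<and> (\<forall>y\<in>M \<inter> U. h (f y) = F y)"
    by (intro exI[of _ U] exI[of _ "\<lambda>x. h (F x)"]) (auto intro: Ck_on_linear_compose[OF assms(1)])
qed

lemmas smooth_on_scaleR = smooth_on_linear_compose[OF bounded_linear_scaleR_right]

lemma smooth_on_diff:
  assumes "smooth_on M f" "smooth_on M g"
  shows "smooth_on M (\<lambda>x. f x - g x)"
  using smooth_on_add[OF assms(1) smooth_on_linear_compose[OF bounded_linear_minus[OF bounded_linear_ident] assms(2)]]
  by simp

section \<open>Derivatives along tangent vectors\<close>

text \<open>Along a curve in \<open>M\<close> with velocity \<open>v\<close>, the chain rule turns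
  either derivative into the velocity of \<open>f \<circ> \<gamma>\<close> at 0, and a derivative in
  one real variable is unique.\<close>

lemma has_derivative_within_tangent_unique:
  assumes "(f has_derivative D) (at x within M)" "(f has_derivative D') (at x within M)"
    and "v \<in> tangent_space M x"
  shows "D v = D' v"
proof -
  obtain \<gamma> where g: "\<gamma> 0 = x" "\<And>t::real. \<gamma> t \<in> M" "(\<gamma> has_vector_derivative v) (at 0)"
    using assms(3) by (auto simp: tangent_space_def)
  have "(f \<circ> \<gamma> has_vector_derivative E v) (at 0)" if "(f has_derivative E) (at x within M)" for E
    using g vector_derivative_diff_chain_within[of \<gamma> v 0 UNIV f E]
      has_derivative_subset[OF that, of "range \<gamma>"] by auto
  from vector_derivative_unique_at[OF this[OF assms(1)] this[OF assms(2)]] show ?thesis .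
qed

text \<open>\<open>frechet_derivative\<close> picks some derivative within the thin set
  \<open>M\<close>; on tangent vectors any derivative that can be written down may replace
  it.\<close>

lemma tangent_deriv_eq:
  assumes "(f has_derivative D) (at x within M)" "v \<in> tangent_space M x"
  shows "tangent_deriv M f x v = D v"
  unfolding tangent_deriv_def
  by (rule has_derivative_within_tangent_unique[OF _ assms])
    (use assms frechet_derivative_works differentiableI in blast)

lemma smooth_on_has_derivative:
  assumes "smooth_on M f" "x \<in> M"
  obtains D where "(f has_derivative D) (at x within M)"
proof -
  obtain U F where U: "open U" "x \<in> U" "\<And>k. Ck_on k U F" "\<And>y. y \<in> M \<Longrightarrow> y \<in> U \<Longrightarrow> f y = F y"
    using smooth_onE[OF assms] by metis
  obtain D where "(F has_derivative D) (at x)" using U(2) U(3)[of 1] by auto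
  then have "(F has_derivative D) (at x within M)" by (rule has_derivative_at_withinI)
  moreover obtain e where "e > 0" "ball x e \<subseteq> U" using U openE by blast
  ultimately have "(f has_derivative D) (at x within M)"
    using U assms(2) by (intro has_derivative_transform_within[of F D x M e f])
     (auto simp: dist_commute subset_iff)
  then show ?thesis by (rule that)
qed

lemma tangent_deriv_works:
  assumes "smooth_on M f" "x \<in> M"
  shows "(f has_derivative tangent_deriv M f x) (at x within M)"
  using smooth_on_has_derivative[OF assms] unfolding tangent_deriv_def
  by (metis differentiableI frechet_derivative_works)

lemma smooth_on_tangent_deriv:
  fixes X :: "'a::euclidean_space \<Rightarrow> 'a" and f :: "'a \<Rightarrow> 'b::real_normed_vector"
  assumes "smooth_on M f" "vector_field_on M X"
  shows "smooth_on M (\<lambda>x. tangent_deriv M f x (X x))"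
  unfolding smooth_on_def
proof
  fix x assume x: "x \<in> M"
  obtain U F where U: "open U" "x \<in> U" "\<And>k. Ck_on k U F" "\<And>y. y \<in> M \<Longrightarrow> y \<in> U \<Longrightarrow> f y = F y"
    using assms(1) x by (rule smooth_onE) auto
  obtain V G where V: "open V" "x \<in> V" "\<And>k. Ck_on k V G" "\<And>y. y \<in> M \<Longrightarrow> y \<in> V \<Longrightarrow> X y = G y"
    using assms(2) x unfolding vector_field_on_def by (metis smooth_onE)
  define W where "W = U \<inter> V"
  have W: "open W" "x \<in> W" "W \<subseteq> U" "W \<subseteq> V" using U V by (auto simp: W_def)
  define F' where "F' = (\<lambda>y. frechet_derivative F (at y))"
  have F': "(F has_derivative F' y) (at y)" if y: "y \<in> W" for y
  proof -
    obtain D where "(F has_derivative D) (at y)" using U(3)[of 1] y W(3) by auto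
    then show ?thesis unfolding F'_def using frechet_derivative_at by metis
  qed
  \<comment> \<open>Smoothness of \<open>F' y v\<close> in \<open>y\<close> is known for a fixed
    direction \<open>v\<close> only, so the varying direction \<open>G y\<close> is expanded in the
    standard basis.\<close>
  define H where "H = (\<lambda>y. \<Sum>b\<in>Basis. (G y \<bullet> b) *\<^sub>R F' y b)"
  have "Ck_on k W H" for k unfolding H_def
  proof (intro Ck_on_sum Ck_on_bilinear[OF bounded_bilinear_scaleR])
    fix b :: 'a
    show "Ck_on k W (\<lambda>x. G x \<bullet> b)"
      by (rule Ck_on_linear_compose[OF bounded_linear_inner_left Ck_on_subset[OF V(3) W(4)]])
    show "Ck_on k W (\<lambda>x. F' x b)" unfolding F'_def
      by (rule Ck_on_frechet_derivative[OF W(1) Ck_on_subset[OF U(3) W(3)]])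
  qed
  moreover have "tangent_deriv M f y (X y) = H y" if y: "y \<in> M" "y \<in> W" for y
  proof -
    obtain e where e: "e > 0" "ball y e \<subseteq> W" using W y openE by blast
    have "(f has_derivative F' y) (at y within M)"
      using has_derivative_at_withinI[OF F'[OF y(2)], of M] y e U(4) W(3)
      by (intro has_derivative_transform_within[of F "F' y" y M e f])
        (auto simp: dist_commute subset_iff)
    then have "tangent_deriv M f y (X y) = F' y (X y)"
      using assms(2) y by (intro tangent_deriv_eq) (auto simp: vector_field_on_def)
    also have "\<dots> = F' y (\<Sum>b\<in>Basis. (G y \<bullet> b) *\<^sub>R b)"
      using V(4)[of y] y W(4) by (auto simp: euclidean_representation)
    also have "\<dots> = H y"
      using has_derivative_linear[OF F'[OF y(2)]] by (simp add: H_def linear_sum linear_cmul)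
    finally show ?thesis .
  qed
  ultimately show "\<exists>U F. open U \<and> x \<in> U \<and> (\<forall>k. Ck_on k U F) \<and>
      (\<forall>y\<in>M \<inter> U. tangent_deriv M f y (X y) = F y)"
    using W by (intro exI[of _ W] exI[of _ H]) auto
qed

text \<open>A trace computed in an overcomplete frame. Each basis vector \<open>b\<close> is
  expanded in the frame, the sums are exchanged, and the coordinates of \<open>L (e i)\<close> are
  collected inside the linear functional \<open>\<epsilon> i\<close>. The separate \<open>L'\<close>
  is there for \<open>levi_civita\<close>, whose values are determined on tangent vectors
  only.\<close>

lemma trace_on_frame:
  fixes S :: "'a::euclidean_space set" and e :: "'i \<Rightarrow> 'a"
  assumes "subspace S" "linear L" "\<And>v. v \<in> S \<Longrightarrow> L v \<in> S" "\<And>v. v \<in> S \<Longrightarrow> L' v = L v"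
    and "finite I" "\<And>i. i \<in> I \<Longrightarrow> e i \<in> S" "\<And>i. i \<in> I \<Longrightarrow> linear (\<epsilon> i)"
    and frame: "\<And>v. v \<in> S \<Longrightarrow> v = (\<Sum>i\<in>I. \<epsilon> i v *\<^sub>R e i)"
  shows "trace_on S L' = (\<Sum>i\<in>I. \<epsilon> i (L (e i)))"
proof -
  define B where "B = (SOME B. independent B \<and> span B = S)"
  have "\<exists>B. independent B \<and> span B = S"
    using basis_exists[of S] span_minimal[OF _ assms(1)] by (metis subset_antisym)
  then have B: "independent B" "span B = S" unfolding B_def by (metis (mono_tags, lifting) someI)+
  have BS: "b \<in> S" if "b \<in> B" for b using B that span_base by blast
  have fin: "finite B" using B finiteI_independent by blast
  have LS: "L (e i) \<in> S" if "i \<in> I" for i using assms that by auto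
  have "representation B (L b) b = (\<Sum>i\<in>I. \<epsilon> i b * representation B (L (e i)) b)" if "b \<in> B" for b
  proof -
    have "L b = L (\<Sum>i\<in>I. \<epsilon> i b *\<^sub>R e i)" using frame[OF BS[OF that]] by simp
    also have "\<dots> = (\<Sum>i\<in>I. \<epsilon> i b *\<^sub>R L (e i))" using assms(2) by (simp add: linear_sum linear_cmul)
    finally show ?thesis
      using B LS assms(1)
      by (simp add: real_vector.representation_sum real_vector.representation_scale subspace_scale)
  qed
  then have "(\<Sum>b\<in>B. representation B (L b) b) = (\<Sum>i\<in>I. \<Sum>b\<in>B. \<epsilon> i b * representation B (L (e i)) b)"
    by (subst sum.swap) simp
  also have "\<dots> = (\<Sum>i\<in>I. \<epsilon> i (L (e i)))"
  proof (rule sum.cong[OF refl])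
    fix i assume i: "i \<in> I"
    have "L (e i) = (\<Sum>b\<in>B. representation B (L (e i)) b *\<^sub>R b)"
      using sum_representation_eq[of B "L (e i)" B] B fin LS[OF i] by simp
    then have "\<epsilon> i (L (e i)) = \<epsilon> i (\<Sum>b\<in>B. representation B (L (e i)) b *\<^sub>R b)" by simp
    also have "\<dots> = (\<Sum>b\<in>B. \<epsilon> i b * representation B (L (e i)) b)"
      using assms(7)[OF i] by (simp add: linear_sum linear_cmul mult.commute)
    finally show "(\<Sum>b\<in>B. \<epsilon> i b * representation B (L (e i)) b) = \<epsilon> i (L (e i))" ..
  qed
  finally show ?thesis
    unfolding trace_on_def Let_def B_def[symmetric] using assms(4)[OF BS] by simp
qed

section \<open>Matrices and the symplectic group\<close>

lemma J_J_left: "J_matrix ** (J_matrix ** x) = - (x :: real^'m^('n::finite + 'n))"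
  by (simp add: matrix_mul_assoc J_sq mm.minus_left)

lemma J_J_right: "x ** J_matrix ** J_matrix = - (x :: real^('n::finite + 'n)^'m)"
  by (simp add: matrix_mul_assoc[symmetric] J_sq mm.minus_right)

lemma transpose_J: "transpose J_matrix = - (J_matrix :: real^('n::finite + 'n)^('n + 'n))"
proof -
  have "transpose J_matrix $ i $ j = (- J_matrix :: real^('n + 'n)^('n + 'n)) $ i $ j" for i j
    by (cases i; cases j) (auto simp: transpose_def J_nth)
  then show ?thesis by (simp add: vec_eq_iff)
qed

lemmas mm_distribs = mm.add_left mm.add_right mm.diff_left mm.diff_right mm.minus_left mm.minus_right
  mm.scaleR_left mm.scaleR_right mm.zero_left mm.zero_right

lemma tr_minus: "transpose (- x) = - transpose (x :: real^'n^'m)"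
  by (simp add: vec_eq_iff transpose_def)

lemma trace_linear: "bounded_linear (trace :: real^'n^'n \<Rightarrow> real)"
  unfolding linear_conv_bounded_linear[symmetric]
  by (auto intro!: linearI simp: trace_def sum.distrib sum_distrib_left)

lemma trace_scaleR: "trace (c *\<^sub>R A) = c * trace (A :: real^'n^'n)"
  by (simp add: trace_def sum_distrib_left)

lemma sp_algebra_iff: "Z \<in> sp_algebra \<longleftrightarrow> J_matrix ** transpose Z = - (Z ** J_matrix)"
  by (auto simp: sp_algebra_def eq_neg_iff_add_eq_0 add.commute)

lemma subspace_sp_algebra: "subspace sp_algebra"
  by (auto simp: subspace_def sp_algebra_iff tr_add tr_scaleR mm_distribs
      linear_0[OF bounded_linear.linear[OF transpose_linear]])

text \<open>Multiply the defining relation by \<open>J_matrix\<close> from both sides. Closure under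
  transposition later supplies the test vector that makes the trace form nondegenerate.\<close>

lemma sp_algebra_transpose:
  assumes "Z \<in> sp_algebra" shows "transpose Z \<in> sp_algebra"
proof -
  have "J_matrix ** (J_matrix ** transpose Z) ** J_matrix = J_matrix ** - (Z ** J_matrix) ** J_matrix"
    using assms by (simp add: sp_algebra_iff)
  then have "- (transpose Z ** J_matrix) = J_matrix ** Z"
    by (simp add: J_sq J_J_right mm_distribs matrix_mul_assoc)
  then show ?thesis by (metis minus_minus sp_algebra_iff transpose_transpose)
qed

text \<open>Solve \<open>x ** J_matrix ** transpose x = J_matrix\<close> for the inverse. On the
  group, inversion is thus the restriction of a linear map, which settles its smoothness and its
  derivative.\<close>

lemma Sp_matrix_inv:
  assumes "x \<in> Sp" shows "matrix_inv x = - (J_matrix ** transpose x ** J_matrix)"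
proof -
  have "matrix_inv x ** (x ** J_matrix ** transpose x) ** J_matrix = matrix_inv x ** J_matrix ** J_matrix"
    using assms by (simp add: Sp_def)
  then have "(matrix_inv x ** x) ** J_matrix ** transpose x ** J_matrix = - matrix_inv x"
    by (simp add: J_J_right matrix_mul_assoc)
  then show ?thesis by (simp add: Sp_inv[OF assms])
qed

lemma Sp_inv_cancel:
  assumes "x \<in> Sp"
  shows "y ** matrix_inv x ** x = y" "y ** x ** matrix_inv x = y"
    "matrix_inv x ** (x ** y) = y" "x ** (matrix_inv x ** y) = y"
  using Sp_inv[OF assms] by (simp_all add: matrix_mul_assoc) (simp_all flip: matrix_mul_assoc)

lemma tangent_space_Sp_iff:
  assumes "x \<in> Sp"
  shows "w \<in> tangent_space Sp x \<longleftrightarrow> matrix_inv x ** w \<in> sp_algebra"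
proof -
  have "w \<in> (\<lambda>Z. x ** Z) ` sp_algebra" if "matrix_inv x ** w \<in> sp_algebra"
    using imageI[OF that, of "\<lambda>Z. x ** Z"] by (simp add: Sp_inv_cancel[OF assms])
  then show ?thesis
    unfolding tangent_space_Sp[OF assms] by (auto simp: Sp_inv_cancel[OF assms])
qed

lemma mult_in_tangent_space_Sp:
  assumes "x \<in> Sp" "Z \<in> sp_algebra" shows "x ** Z \<in> tangent_space Sp x"
  using assms by (simp add: tangent_space_Sp)

lemma subspace_tangent_space_Sp:
  assumes "x \<in> Sp" shows "subspace (tangent_space Sp x)"
  by (rule subspaceI) (simp_all add: tangent_space_Sp_iff[OF assms] mm_distribs
      subspace_0 subspace_add subspace_scale subspace_sp_algebra)

text \<open>The linearisation of the group equation at \<open>x\<close>. It contains no inverse, so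
  it can be differentiated along a vector field; translating it to the identity is conjugation by
  \<open>x\<close>, which is injective.\<close>

lemma tangent_space_Sp_iff_eq:
  assumes x: "x \<in> Sp"
  shows "w \<in> tangent_space Sp x \<longleftrightarrow> w ** J_matrix ** transpose x + x ** J_matrix ** transpose w = 0"
proof -
  define Z where "Z = matrix_inv x ** w"
  have w: "w = x ** Z" by (simp add: Z_def Sp_inv_cancel[OF x])
  have e: "w ** J_matrix ** transpose x + x ** J_matrix ** transpose w =
      x ** (Z ** J_matrix + J_matrix ** transpose Z) ** transpose x"
    by (simp add: w matrix_transpose_mul matrix_mul_assoc mm_distribs)
  have "x ** W ** transpose x = 0 \<longleftrightarrow> W = 0" for W
  proof
    assume "x ** W ** transpose x = 0"
    then have "matrix_inv x ** (x ** W ** transpose x) ** transpose (matrix_inv x) = 0"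
      by (simp add: mm_distribs)
    moreover have "matrix_inv x ** (x ** W ** transpose x) ** transpose (matrix_inv x) =
        (matrix_inv x ** x) ** W ** transpose (matrix_inv x ** x)"
      by (simp add: matrix_transpose_mul matrix_mul_assoc)
    ultimately show "W = 0" by (simp add: Sp_inv[OF x] transpose_mat)
  qed (simp add: mm_distribs)
  then show ?thesis
    unfolding e by (simp add: tangent_space_Sp_iff[OF x] Z_def[symmetric] sp_algebra_def)
qed

lemma matrix_inv_has_derivative:
  assumes "x \<in> Sp"
  shows "(matrix_inv has_derivative (\<lambda>w. - (J_matrix ** transpose w ** J_matrix))) (at x within Sp)"
proof -
  have "((\<lambda>y. - (J_matrix ** transpose y ** J_matrix)) has_derivative
      (\<lambda>w. - (J_matrix ** transpose w ** J_matrix))) (at x within Sp)"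
    by (intro has_derivative_minus bounded_linear.has_derivative[OF mm.bounded_linear_left]
        bounded_linear.has_derivative[OF mm.bounded_linear_right]
        bounded_linear.has_derivative[OF transpose_linear] has_derivative_ident)
  then show ?thesis
    by (rule has_derivative_transform[OF assms, rotated]) (simp add: Sp_matrix_inv)
qed

text \<open>The linear extension of inversion used for the derivative gives the familiar
  \<open>- x^-1 w x^-1\<close> in tangent directions, because there
  \<open>J_matrix ** transpose Z ** J_matrix = Z\<close> for \<open>Z = x^-1 w\<close>.\<close>

lemma matrix_inv_derivative_tangent:
  assumes x: "x \<in> Sp" and w: "w \<in> tangent_space Sp x"
  shows "- (J_matrix ** transpose w ** J_matrix) = - (matrix_inv x ** w ** matrix_inv x)"
proof -
  define Z where "Z = matrix_inv x ** w"
  have Z: "w = x ** Z" "Z \<in> sp_algebra"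
    using w by (simp_all add: Z_def Sp_inv_cancel[OF x] tangent_space_Sp_iff[OF x])
  have "J_matrix ** transpose w ** J_matrix = (J_matrix ** transpose Z) ** transpose x ** J_matrix"
    by (simp add: Z matrix_transpose_mul matrix_mul_assoc)
  also have "\<dots> = Z ** matrix_inv x"
    using Z(2) by (simp add: sp_algebra_iff Sp_matrix_inv[OF x] mm_distribs matrix_mul_assoc)
  finally show ?thesis by (simp add: Z_def)
qed

lemma smooth_on_matrix_mult:
  "smooth_on M f \<Longrightarrow> smooth_on M g \<Longrightarrow> smooth_on M (\<lambda>x. (f x :: real^'n^'m) ** (g x :: real^'p^'n))"
  by (rule smooth_on_bilinear[OF mm_bilinear])

lemma smooth_on_ident: "smooth_on M (\<lambda>x. x)"
  by (rule smooth_on_bounded_linear[OF bounded_linear_ident])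

lemma smooth_on_matrix_inv: "smooth_on Sp matrix_inv"
proof -
  have "smooth_on Sp (\<lambda>x. J_matrix ** transpose x ** J_matrix)"
    by (intro smooth_on_matrix_mult smooth_on_const smooth_on_bounded_linear transpose_linear)
  from smooth_on_linear_compose[OF bounded_linear_minus[OF bounded_linear_ident] this]
  show ?thesis by (subst smooth_on_cong[OF Sp_matrix_inv])
qed

lemma vector_field_left_invariant:
  assumes "Z \<in> sp_algebra" shows "vector_field_on Sp (\<lambda>y. y ** Z)"
  unfolding vector_field_on_def using mult_in_tangent_space_Sp[OF _ assms]
  by (auto intro!: smooth_on_matrix_mult smooth_on_ident smooth_on_const)

section \<open>The Levi-Civita connection\<close>

text \<open>On left-invariant fields \<open>x ** A\<close>, \<open>x ** B\<close> this is half the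
  bracket, \<open>x ** (A ** B - B ** A) / 2\<close>, as for every bi-invariant metric. The ambient
  formula covers arbitrary fields without expanding them in a left-invariant frame.\<close>

definition sp_connection :: "(real^('n::finite + 'n)^('n + 'n)) connection" where
  "sp_connection Y x w = tangent_deriv Sp Y x w
     - (1/2) *\<^sub>R (w ** matrix_inv x ** Y x + Y x ** matrix_inv x ** w)"

text \<open>Differentiating the tangency equation of \<open>Y\<close> along \<open>w\<close>
  measures how far the ambient derivative is from being tangent. The defect is symmetric in
  \<open>x^-1 w\<close> and \<open>x^-1 Y\<close>, and half their anticommutator, translated to
  \<open>x\<close>, removes it.\<close>

lemma sp_connection_tangent:
  assumes Y: "vector_field_on Sp Y" and x: "x \<in> Sp" and w: "w \<in> tangent_space Sp x"
  shows "sp_connection Y x w \<in> tangent_space Sp x"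
proof -
  let ?J = "J_matrix"
  define D where "D = tangent_deriv Sp Y x"
  have D: "(Y has_derivative D) (at x within Sp)"
    unfolding D_def using Y x by (intro tangent_deriv_works) (auto simp: vector_field_on_def)
  have "((\<lambda>y. (Y y ** ?J) ** transpose y + (y ** ?J) ** transpose (Y y)) has_derivative
      (\<lambda>w. (Y x ** ?J) ** transpose w + (D w ** ?J) ** transpose x
        + ((x ** ?J) ** transpose (D w) + (w ** ?J) ** transpose (Y x)))) (at x within Sp)"
    by (intro has_derivative_add mm.FDERIV bounded_linear.has_derivative[OF mm.bounded_linear_left]
        bounded_linear.has_derivative[OF transpose_linear] has_derivative_ident D)
  moreover have "((\<lambda>y. (Y y ** ?J) ** transpose y + (y ** ?J) ** transpose (Y y)) has_derivative
      (\<lambda>w. 0)) (at x within Sp)"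
    by (rule has_derivative_transform[OF x _ has_derivative_const[of 0]])
      (use Y in \<open>auto simp: vector_field_on_def tangent_space_Sp_iff_eq\<close>)
  ultimately have E: "Y x ** ?J ** transpose w + D w ** ?J ** transpose x
        + (x ** ?J ** transpose (D w) + w ** ?J ** transpose (Y x)) = 0"
    by (rule has_derivative_within_tangent_unique) (rule w)
  define A where "A = matrix_inv x ** w"
  define B where "B = matrix_inv x ** Y x"
  have A: "w = x ** A" "?J ** transpose A = - (A ** ?J)"
    using w by (simp_all add: A_def Sp_inv_cancel[OF x] tangent_space_Sp_iff[OF x] sp_algebra_iff)
  have "Y x \<in> tangent_space Sp x" using Y x by (simp add: vector_field_on_def)
  then have B: "Y x = x ** B" "?J ** transpose B = - (B ** ?J)"
    by (simp_all add: B_def Sp_inv_cancel[OF x] tangent_space_Sp_iff[OF x] sp_algebra_iff)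
  \<comment> \<open>The arbitrary prefix \<open>U\<close> lets the relations for \<open>A\<close>
    and \<open>B\<close> act inside left-associated products.\<close>
  have J3: "U ** ?J ** transpose A = - (U ** A ** ?J)" "U ** ?J ** transpose B = - (U ** B ** ?J)"
    for U :: "real^('a + 'a)^('a + 'a)"
    using A(2) B(2) by (simp_all add: matrix_mul_assoc[symmetric] mm_distribs)
  have N: "sp_connection Y x w = D w - (1/2) *\<^sub>R (x ** A ** B + x ** B ** A)"
    unfolding sp_connection_def D_def[symmetric] A(1) B(1)
    by (simp add: matrix_mul_assoc Sp_inv_cancel[OF x])
  have "D w ** ?J ** transpose x + x ** ?J ** transpose (D w)
     = x ** B ** A ** ?J ** transpose x + x ** A ** B ** ?J ** transpose x"
    using E unfolding A(1) B(1) matrix_transpose_mul matrix_mul_assoc J3 mm_distribs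
    by (simp add: algebra_simps add_eq_0_iff)
  then show ?thesis
    unfolding tangent_space_Sp_iff_eq[OF x] N tr_diff tr_add tr_scaleR mm_distribs matrix_transpose_mul
      matrix_mul_assoc J3
    by (simp add: algebra_simps scaleR_add_left[symmetric])
qed

lemma sp_connection_affine: 
  "affine_connection Sp (sp_connection :: (real^('n::finite + 'n)^('n + 'n)) connection)"
  unfolding affine_connection_def
proof (intro conjI allI ballI impI)
  fix X Y :: "real^('n + 'n)^('n + 'n) \<Rightarrow> real^('n + 'n)^('n + 'n)"
  assume "vector_field_on Sp X \<and> vector_field_on Sp Y"
  then have X: "vector_field_on Sp X" "smooth_on Sp X" and Y: "smooth_on Sp Y"
    by (auto simp: vector_field_on_def)
  show "smooth_on Sp (\<lambda>x. sp_connection Y x (X x))"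
    unfolding sp_connection_def
    by (intro smooth_on_diff smooth_on_tangent_deriv X Y smooth_on_scaleR smooth_on_add
        smooth_on_matrix_mult smooth_on_matrix_inv)
next
  fix Y :: "real^('n + 'n)^('n + 'n) \<Rightarrow> real^('n + 'n)^('n + 'n)" and x u w :: "real^('n + 'n)^('n + 'n)" and a b
  assume "vector_field_on Sp Y" and x: "x \<in> Sp"
  then have "linear (tangent_deriv Sp Y x)"
    by (auto simp: vector_field_on_def intro: tangent_deriv_works has_derivative_linear)
  then show "sp_connection Y x (a *\<^sub>R u + b *\<^sub>R w) = a *\<^sub>R sp_connection Y x u + b *\<^sub>R sp_connection Y x w"
    by (simp add: sp_connection_def linear_add linear_cmul mm_distribs algebra_simps)
next
  fix Y Z :: "real^('n + 'n)^('n + 'n) \<Rightarrow> real^('n + 'n)^('n + 'n)" and x w :: "real^('n + 'n)^('n + 'n)"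
  assume YZ: "vector_field_on Sp Y \<and> vector_field_on Sp Z" and x: "x \<in> Sp"
    and w: "w \<in> tangent_space Sp x"
  have "((\<lambda>y. Y y + Z y) has_derivative (\<lambda>w. tangent_deriv Sp Y x w + tangent_deriv Sp Z x w)) (at x within Sp)"
    using YZ x by (intro has_derivative_add tangent_deriv_works) (auto simp: vector_field_on_def)
  from tangent_deriv_eq[OF this w]
  show "sp_connection (\<lambda>y. Y y + Z y) x w = sp_connection Y x w + sp_connection Z x w"
    by (simp add: sp_connection_def mm_distribs algebra_simps)
next
  fix f :: "real^('n + 'n)^('n + 'n) \<Rightarrow> real" and Y :: "real^('n + 'n)^('n + 'n) \<Rightarrow> real^('n + 'n)^('n + 'n)"
    and x w :: "real^('n + 'n)^('n + 'n)"
  assume YZ: "smooth_on Sp f \<and> vector_field_on Sp Y" and x: "x \<in> Sp"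
    and w: "w \<in> tangent_space Sp x"
  have "((\<lambda>y. f y *\<^sub>R Y y) has_derivative
      (\<lambda>w. f x *\<^sub>R tangent_deriv Sp Y x w + tangent_deriv Sp f x w *\<^sub>R Y x)) (at x within Sp)"
    using YZ x by (intro has_derivative_scaleR tangent_deriv_works) (auto simp: vector_field_on_def)
  from tangent_deriv_eq[OF this w]
  show "sp_connection (\<lambda>y. f y *\<^sub>R Y y) x w = tangent_deriv Sp f x w *\<^sub>R Y x + f x *\<^sub>R sp_connection Y x w"
    by (simp add: sp_connection_def mm_distribs algebra_simps)
qed (rule sp_connection_tangent)

text \<open>The correction term is symmetric in the two fields and drops out of the
  difference.\<close>

lemma sp_connection_torsion_free: "torsion_free Sp sp_connection"
  by (simp add: torsion_free_def sp_connection_def lie_bracket_def algebra_simps)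

text \<open>After translation to the identity the terms with \<open>DY\<close> and \<open>DZ\<close>
  agree on both sides. The derivative of the inverse contributes the traces of
  \<open>A ** B ** C\<close> and \<open>B ** A ** C\<close>; the halved anticommutators give the
  same sum because the trace is cyclic.\<close>

lemma sp_connection_metric: 
  "metric_compatible Sp sp_metric (sp_connection :: (real^('n::finite + 'n)^('n + 'n)) connection)"
  unfolding metric_compatible_def
proof (intro allI impI ballI)
  fix Y Z :: "real^('n + 'n)^('n + 'n) \<Rightarrow> real^('n + 'n)^('n + 'n)" and x w :: "real^('n + 'n)^('n + 'n)"
  assume YZ: "vector_field_on Sp Y \<and> vector_field_on Sp Z" and x: "x \<in> Sp"
    and w: "w \<in> tangent_space Sp x"
  define DY DZ where "DY = tangent_deriv Sp Y x" and "DZ = tangent_deriv Sp Z x"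
  have D: "(Y has_derivative DY) (at x within Sp)" "(Z has_derivative DZ) (at x within Sp)"
    unfolding DY_def DZ_def using YZ x by (auto simp: vector_field_on_def intro: tangent_deriv_works)
  let ?i = "\<lambda>w. - (J_matrix ** transpose w ** J_matrix)"
  have "((\<lambda>y. - trace ((matrix_inv y ** Y y) ** (matrix_inv y ** Z y))) has_derivative
     (\<lambda>w. - trace ((matrix_inv x ** Y x) ** (matrix_inv x ** DZ w + ?i w ** Z x)
       + (matrix_inv x ** DY w + ?i w ** Y x) ** (matrix_inv x ** Z x)))) (at x within Sp)"
    by (intro has_derivative_minus bounded_linear.has_derivative[OF trace_linear] mm.FDERIV D matrix_inv_has_derivative x)
  note d = tangent_deriv_eq[OF this w]
  define A B C where "A = matrix_inv x ** w" and "B = matrix_inv x ** Y x" and "C = matrix_inv x ** Z x"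
  have i: "?i w ** U = - (A ** matrix_inv x ** U)" for U :: "real^('n + 'n)^('n + 'n)"
    using matrix_inv_derivative_tangent[OF x w] by (simp add: A_def mm_distribs)
  have d': "tangent_deriv Sp (\<lambda>y. sp_metric y (Y y) (Z y)) x w =
      - trace (B ** (matrix_inv x ** DZ w - A ** C) + (matrix_inv x ** DY w - A ** B) ** C)"
    unfolding sp_metric_def left_invariant_def d i
    by (simp add: B_def C_def matrix_mul_assoc)
  have N: "matrix_inv x ** sp_connection Y x w = matrix_inv x ** DY w - (1/2) *\<^sub>R (A ** B + B ** A)"
    "matrix_inv x ** sp_connection Z x w = matrix_inv x ** DZ w - (1/2) *\<^sub>R (A ** C + C ** A)"
    by (simp_all add: sp_connection_def DY_def DZ_def A_def B_def C_def mm_distribs matrix_mul_assoc)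
  have t: "trace (B ** C ** A) = trace (A ** B ** C)"
    by (simp add: trace_mul_sym[of "B ** C" A] matrix_mul_assoc)
  show "tangent_deriv Sp (\<lambda>y. sp_metric y (Y y) (Z y)) x w =
      sp_metric x (sp_connection Y x w) (Z x) + sp_metric x (Y x) (sp_connection Z x w)"
    unfolding d'
    unfolding sp_metric_def left_invariant_def N B_def[symmetric] C_def[symmetric]
    by (simp add: mm_distribs trace_add trace_sub trace_scaleR matrix_mul_assoc t algebra_simps)
qed

text \<open>The form is indefinite, but pairing \<open>x ** Z\<close> with
  \<open>x ** transpose Z\<close> yields minus the sum of the squared entries of
  \<open>Z\<close>.\<close>

lemma sp_metric_nondegenerate:
  assumes x: "x \<in> Sp" and u: "u \<in> tangent_space Sp x"
    and z: "\<And>w. w \<in> tangent_space Sp x \<Longrightarrow> sp_metric x u w = 0"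
  shows "u = 0"
proof -
  define Z where "Z = matrix_inv x ** u"
  have Z: "Z \<in> sp_algebra" using u by (simp add: Z_def tangent_space_Sp_iff[OF x])
  then have "sp_metric x u (x ** transpose Z) = 0"
    using mult_in_tangent_space_Sp[OF x sp_algebra_transpose] z by blast
  then have "trace (Z ** transpose Z) = 0"
    by (simp add: sp_metric_def left_invariant_def Z_def[symmetric] Sp_inv_cancel[OF x])
  then have "(\<Sum>i\<in>UNIV. \<Sum>j\<in>UNIV. (Z $ i $ j)\<^sup>2) = 0"
    by (simp add: trace_def matrix_matrix_mult_def transpose_def power2_eq_square)
  then have "Z = 0"
    by (simp add: sum_nonneg_eq_0_iff sum_nonneg vec_eq_iff)
  then show ?thesis using Sp_inv_cancel(4)[OF x, of u] by (simp add: Z_def mm_distribs)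
qed

text \<open>The difference of two torsion-free metric connections gives a trilinear form that is symmetric in
  two arguments and skew in another two, hence vanishes.\<close>

lemma levi_civita_unique:
  assumes "affine_connection Sp N" "metric_compatible Sp sp_metric N" "torsion_free Sp N"
    and "affine_connection Sp N'" "metric_compatible Sp sp_metric N'" "torsion_free Sp N'"
    and Y: "vector_field_on Sp Y" and x: "x \<in> Sp" and w: "w \<in> tangent_space Sp x"
  shows "N Y x w = N' Y x w"
proof -
  define S where "S = (\<lambda>Y w. N Y x w - N' Y x w)"
  define g where "g = sp_metric x"
  have gl: "g (u - u') w = g u w - g u' w" and gr: "g w (u - u') = g w u - g w u'" for u u' w
    by (simp_all add: g_def sp_metric_def left_invariant_def mm_distribs trace_sub)
  have gc: "g u w = g w u" for u w
    unfolding g_def sp_metric_def left_invariant_def by (simp only: trace_mul_sym[of "matrix_inv x ** u"])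
  have torsion: "S Y (X x) = S X (Y x)" if "vector_field_on Sp X" "vector_field_on Sp Y" for X Y
  proof -
    have "N Y x (X x) - N X x (Y x) = N' Y x (X x) - N' X x (Y x)"
      using assms(3,6) that x unfolding torsion_free_def by simp
    then show ?thesis by (simp add: S_def algebra_simps)
  qed
  have skew: "g (S Y w) (Z x) = - g (Y x) (S Z w)"
    if "vector_field_on Sp Y" "vector_field_on Sp Z" "w \<in> tangent_space Sp x" for Y Z w
  proof -
    have "g (N Y x w) (Z x) + g (Y x) (N Z x w) = g (N' Y x w) (Z x) + g (Y x) (N' Z x w)"
      using HOL.trans[OF HOL.sym[OF assms(2)[unfolded metric_compatible_def, rule_format, OF conjI[OF that(1,2)] x that(3)]]
          assms(5)[unfolded metric_compatible_def, rule_format, OF conjI[OF that(1,2)] x that(3)]]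
      by (simp add: g_def)
    then show ?thesis by (simp add: S_def gl gr)
  qed
  have tang: "X x \<in> tangent_space Sp x" if "vector_field_on Sp X" for X
    using that x by (simp add: vector_field_on_def)
  have zero: "g (S Y (X x)) (Z x) = 0"
    if "vector_field_on Sp X" "vector_field_on Sp Y" "vector_field_on Sp Z" for X Y Z
  proof -
    have "g (S Y (X x)) (Z x) = - g (S Z (X x)) (Y x)"
      using skew[OF that(2,3) tang[OF that(1)]] gc by simp
    also have "\<dots> = - g (S X (Z x)) (Y x)" using torsion that by simp
    also have "\<dots> = g (S Y (Z x)) (X x)" using skew[OF that(1,2) tang[OF that(3)]] gc by simp
    also have "\<dots> = g (S Z (Y x)) (X x)" using torsion that by simp
    also have "\<dots> = - g (S X (Y x)) (Z x)" using skew[OF that(3,1) tang[OF that(2)]] gc by simp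
    also have "\<dots> = - g (S Y (X x)) (Z x)" using torsion that by simp
    finally show ?thesis by simp
  qed
  \<comment> \<open>The cyclic argument swaps field and direction, so it is carried out for fields.
    Left-invariant fields pass from there to arbitrary tangent vectors at \<open>x\<close>.\<close>
  have ext: "\<exists>X. vector_field_on Sp X \<and> X x = u" if "u \<in> tangent_space Sp x" for u
    using vector_field_left_invariant that unfolding tangent_space_Sp[OF x] by blast
  have "S Y w = 0"
  proof (rule sp_metric_nondegenerate[OF x])
    show "S Y w \<in> tangent_space Sp x"
      using assms(1,4) Y x w subspace_diff[OF subspace_tangent_space_Sp[OF x]]
      by (simp add: S_def affine_connection_def)
    show "sp_metric x (S Y w) u = 0" if u: "u \<in> tangent_space Sp x" for u
      using ext[OF w] ext[OF u] zero Y unfolding g_def by metis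
  qed
  then show ?thesis by (simp add: S_def)
qed

text \<open>The explicit connection witnesses that the choice in \<open>levi_civita\<close>
  succeeds, and uniqueness identifies the chosen connection with it on tangent vectors.\<close>

lemma levi_civita_Sp:
  assumes "vector_field_on Sp Y" "x \<in> Sp" "w \<in> tangent_space Sp x"
  shows "levi_civita Sp sp_metric Y x w = sp_connection Y x w"
proof -
  let ?P = "\<lambda>N. affine_connection Sp N \<and> metric_compatible Sp sp_metric N \<and> torsion_free Sp N"
  have "?P (levi_civita Sp sp_metric)"
    unfolding levi_civita_def
    by (rule someI[of ?P sp_connection])
      (simp add: sp_connection_affine sp_connection_metric sp_connection_torsion_free)
  then show ?thesis
    using levi_civita_unique[OF _ _ _ sp_connection_affine sp_connection_metric
        sp_connection_torsion_free assms] by blast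
qed

section \<open>Gradients and divergence\<close>

text \<open>The average of \<open>M\<close> and its image under the involution taking
  \<open>M\<close> to \<open>J_matrix ** transpose M ** J_matrix\<close>, whose fixed points form
  \<open>sp_algebra\<close>. It is the orthogonal projection for the trace form.\<close>

definition sp_proj :: "real^('n::finite + 'n)^('n + 'n) \<Rightarrow> real^('n + 'n)^('n + 'n)" where
  "sp_proj M = (1/2) *\<^sub>R (M + J_matrix ** transpose M ** J_matrix)"

lemma linear_sp_proj: "linear sp_proj"
  by (auto intro!: linearI simp: sp_proj_def tr_add tr_scaleR mm_distribs algebra_simps)

lemma sp_proj_in: "sp_proj M \<in> sp_algebra"
  by (simp add: sp_algebra_iff sp_proj_def tr_add tr_scaleR mm_distribs matrix_transpose_mul transpose_J
      tr_minus matrix_mul_assoc J_sq J_J_right algebra_simps)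

lemma sp_proj_id:
  assumes "Z \<in> sp_algebra" shows "sp_proj Z = Z"
proof -
  have "J_matrix ** transpose Z ** J_matrix = Z"
    using assms by (simp add: sp_algebra_iff mm_distribs J_J_right)
  then show ?thesis by (simp add: sp_proj_def scaleR_2[symmetric])
qed

lemma trace_transpose: "trace (transpose A) = trace A"
  by (simp add: trace_def transpose_def)

lemma trace_uminus: "trace (- A) = - trace (A :: real^'n^'n)"
  by (simp add: trace_def sum_negf)

text \<open>Orthogonality of the projection: moving \<open>J_matrix\<close> past \<open>Z\<close>
  transposes \<open>Z\<close> up to sign, and the trace is invariant under transposition and cyclic
  shifts.\<close>

lemma trace_sp_proj_mult:
  assumes "Z \<in> sp_algebra" shows "trace (sp_proj M ** Z) = trace (M ** Z)"
proof -
  have "J_matrix ** Z = - (transpose Z ** J_matrix)"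
    using sp_algebra_transpose[OF assms] by (simp add: sp_algebra_iff)
  then have "J_matrix ** transpose M ** J_matrix ** Z = - (J_matrix ** (transpose M ** transpose Z ** J_matrix))"
    by (simp add: matrix_mul_assoc[symmetric] mm_distribs)
  moreover have "trace (J_matrix ** (transpose M ** transpose Z ** J_matrix))
      = trace ((transpose M ** transpose Z ** J_matrix) ** J_matrix)" by (rule trace_mul_sym)
  moreover have "trace (transpose M ** transpose Z) = trace (M ** Z)"
    by (simp add: matrix_transpose_mul[symmetric] trace_transpose trace_mul_sym[of Z M])
  ultimately have "trace (J_matrix ** transpose M ** J_matrix ** Z) = trace (M ** Z)"
    by (simp add: J_J_right trace_uminus)
  then show ?thesis
    by (simp add: sp_proj_def mm_distribs trace_add trace_scaleR)
qed

text \<open>On the group this equals \<open>- x ** sp_proj (R ** x)\<close>. Rewriting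
  \<open>x ** J_matrix ** transpose x\<close> as \<open>J_matrix\<close> leaves a polynomial in
  \<open>x\<close>, which is smooth and easy to differentiate.\<close>

definition sp_gradient :: "real^('n::finite + 'n)^('n + 'n) \<Rightarrow> real^('n + 'n)^('n + 'n) \<Rightarrow> real^('n + 'n)^('n + 'n)" where
  "sp_gradient R x = - (1/2) *\<^sub>R (x ** R ** x + J_matrix ** transpose R ** J_matrix)"

lemma matrix_inv_sp_gradient:
  assumes x: "x \<in> Sp" shows "matrix_inv x ** sp_gradient R x = - sp_proj (R ** x)"
proof -
  have "matrix_inv x ** J_matrix = J_matrix ** transpose x"
    by (simp add: Sp_matrix_inv[OF x] mm_distribs J_J_right)
  then show ?thesis
    by (simp add: sp_gradient_def sp_proj_def mm_distribs matrix_mul_assoc Sp_inv[OF x] matrix_transpose_mul)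
qed

lemma sp_gradient_tangent: "x \<in> Sp \<Longrightarrow> sp_gradient R x \<in> tangent_space Sp x"
  by (simp add: tangent_space_Sp_iff matrix_inv_sp_gradient subspace_neg[OF subspace_sp_algebra] sp_proj_in)

lemma sp_metric_sp_gradient:
  assumes x: "x \<in> Sp" and w: "w \<in> tangent_space Sp x"
  shows "sp_metric x (sp_gradient R x) w = trace (R ** w)"
proof -
  have "sp_metric x (sp_gradient R x) w = trace (R ** x ** (matrix_inv x ** w))"
    using w by (simp add: sp_metric_def left_invariant_def matrix_inv_sp_gradient[OF x] mm_distribs
        trace_uminus trace_sp_proj_mult tangent_space_Sp_iff[OF x])
  then show ?thesis by (simp add: matrix_mul_assoc Sp_inv_cancel[OF x])
qed

text \<open>Nondegeneracy makes the description in \<open>gradient\<close> unique. The hypothesis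
  concerns values on the group only, which suits functions extended by zero such as
  \<open>phi\<close>.\<close>

lemma gradient_trace:
  assumes f: "\<And>y. y \<in> Sp \<Longrightarrow> f y = trace (R ** y)" and x: "x \<in> Sp"
  shows "gradient Sp sp_metric f x = sp_gradient R x"
proof -
  have "((\<lambda>y. trace (R ** y)) has_derivative (\<lambda>w. trace (R ** w))) (at x within Sp)"
    by (intro bounded_linear.has_derivative[OF trace_linear]
        bounded_linear.has_derivative[OF mm.bounded_linear_right] has_derivative_ident)
  then have "(f has_derivative (\<lambda>w. trace (R ** w))) (at x within Sp)"
    by (rule has_derivative_transform[OF x f, rotated])
  from tangent_deriv_eq[OF this]
  have d: "tangent_deriv Sp f x w = trace (R ** w)" if "w \<in> tangent_space Sp x" for w
    using that .
  show ?thesis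
    unfolding gradient_def
  proof (rule the_equality)
    show "sp_gradient R x \<in> tangent_space Sp x \<and>
        (\<forall>v\<in>tangent_space Sp x. sp_metric x (sp_gradient R x) v = tangent_deriv Sp f x v)"
      by (simp add: sp_gradient_tangent[OF x] sp_metric_sp_gradient[OF x] d)
  next
    fix u assume u: "u \<in> tangent_space Sp x \<and>
        (\<forall>v\<in>tangent_space Sp x. sp_metric x u v = tangent_deriv Sp f x v)"
    have "u - sp_gradient R x = 0"
    proof (rule sp_metric_nondegenerate[OF x])
      show "u - sp_gradient R x \<in> tangent_space Sp x"
        using u by (simp add: subspace_diff[OF subspace_tangent_space_Sp[OF x]] sp_gradient_tangent[OF x])
      fix w assume w: "w \<in> tangent_space Sp x"
      have "sp_metric x (u - sp_gradient R x) w = sp_metric x u w - sp_metric x (sp_gradient R x) w"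
        by (simp add: sp_metric_def left_invariant_def mm_distribs trace_sub)
      then show "sp_metric x (u - sp_gradient R x) w = 0"
        using u w by (simp add: sp_metric_sp_gradient[OF x] d)
    qed
    then show "u = sp_gradient R x" by simp
  qed
qed

section \<open>Elementary matrices and the trace of an anticommutator\<close>

lemma axis_axis_nth: "axis i (axis j c) $ k $ l = (if k = i \<and> l = j then c else 0)"
  by (simp add: axis_def)

lemma mult_axis_mult_nth:
  "((U :: real^'n^'m) ** axis i (axis j 1) ** (V :: real^'p^'q)) $ k $ l = U $ k $ i * V $ j $ l"
proof -
  have "(U ** axis i (axis j 1)) $ k $ b = (if b = j then U $ k $ i else 0)" for b
    by (simp add: matrix_matrix_mult_def axis_axis_nth if_distrib cong: if_cong)
  then show ?thesis
    by (simp add: matrix_matrix_mult_def[of "U ** axis i (axis j 1)"] if_distrib[where f="\<lambda>z. z * c" for c] cong: if_cong)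
qed

lemma transpose_axis: "transpose (axis i (axis j c)) = axis j (axis i c)"
  by (auto simp: vec_eq_iff transpose_def axis_axis_nth)

lemma matrix_eq_sum_axis: "(A :: real^'n^'m) = (\<Sum>(i,j)\<in>UNIV. A $ i $ j *\<^sub>R axis i (axis j 1))"
proof -
  have "(\<Sum>p\<in>UNIV. (case p of (i,j) \<Rightarrow> A $ i $ j *\<^sub>R axis i (axis j 1)) $ k $ l)
     = (\<Sum>p\<in>UNIV. if p = (k,l) then A $ k $ l else 0)" for k l
    by (rule sum.cong) (auto simp: axis_axis_nth split: if_splits)
  then show ?thesis by (simp add: vec_eq_iff)
qed

lemma sum_mult_entries:
  "(\<Sum>(i,j)\<in>UNIV. A $ i $ j * B $ i $ j) = trace (A ** transpose B)"
  by (simp add: trace_def matrix_matrix_mult_def transpose_def sum.cartesian_product UNIV_Times_UNIV[symmetric]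
      del: UNIV_Times_UNIV)

text \<open>Source of the constant 2n+1. The two plain products with an elementary matrix each sum
  to 2n times \<open>trace Q\<close>, the two products with its \<open>J_matrix\<close>-image each
  to \<open>trace Q\<close>, and the projection halves the total.\<close>

lemma trace_sp_proj_anticommutator:
  fixes Q :: "real^('n::finite + 'n)^('n + 'n)"
  shows "(\<Sum>(i,j)\<in>UNIV. (sp_proj (axis i (axis j 1)) ** Q + Q ** sp_proj (axis i (axis j 1))) $ i $ j)
    = (2 * real CARD('n) + 1) * trace Q"
proof -
  let ?J = "J_matrix :: real^('n + 'n)^('n + 'n)"
  have e: "(sp_proj (axis i (axis j 1)) ** Q + Q ** sp_proj (axis i (axis j 1))) $ i $ j
      = (Q $ j $ j + Q $ i $ i + ?J $ i $ j * (?J ** Q) $ i $ j + (Q ** ?J) $ i $ j * ?J $ i $ j) / 2" for i j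
  proof -
    have "(axis i (axis j 1) ** Q) $ i $ j = Q $ j $ j"
      using mult_axis_mult_nth[of "mat 1" i j Q i j] by simp (simp add: mat_def)
    moreover have "(Q ** axis i (axis j 1)) $ i $ j = Q $ i $ i"
      using mult_axis_mult_nth[of Q i j "mat 1" i j] by simp (simp add: mat_def)
    moreover have "(?J ** axis j (axis i 1) ** ?J ** Q) $ i $ j = ?J $ i $ j * (?J ** Q) $ i $ j"
      using mult_axis_mult_nth[of ?J j i "?J ** Q" i j] by (simp add: matrix_mul_assoc)
    moreover have "(Q ** ?J ** axis j (axis i 1) ** ?J) $ i $ j = (Q ** ?J) $ i $ j * ?J $ i $ j"
      by (rule mult_axis_mult_nth)
    ultimately show ?thesis
      by (simp add: sp_proj_def transpose_axis mm_distribs matrix_mul_assoc add_divide_distrib)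
  qed
  have s1: "(\<Sum>(i::'n + 'n,j)\<in>UNIV. Q $ j $ j) = 2 * real CARD('n) * trace Q"
    "(\<Sum>(i,j::'n + 'n)\<in>UNIV. Q $ i $ i) = 2 * real CARD('n) * trace Q"
    by (simp_all add: trace_def UNIV_Times_UNIV[symmetric] sum.cartesian_product[symmetric]
        sum_distrib_left[symmetric] del: UNIV_Times_UNIV)
  have "(\<Sum>(i,j)\<in>UNIV. ?J $ i $ j * (?J ** Q) $ i $ j) = trace (?J ** Q ** transpose ?J)"
    unfolding sum_mult_entries[symmetric] by (simp add: mult.commute)
  also have "\<dots> = trace Q"
    by (simp add: transpose_J mm_distribs trace_uminus trace_mul_sym[of "?J ** Q"] J_J_left)
  finally have s2: "(\<Sum>(i,j)\<in>UNIV. ?J $ i $ j * (?J ** Q) $ i $ j) = trace Q" .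
  have s3: "(\<Sum>(i,j)\<in>UNIV. (Q ** ?J) $ i $ j * ?J $ i $ j) = trace Q"
    unfolding sum_mult_entries by (simp add: transpose_J mm_distribs J_J_right)
  show ?thesis
    unfolding e
    using s1 s2 s3
    by (simp add: case_prod_unfold sum.distrib sum_divide_distrib[symmetric] field_simps)
qed

lemma divergence_sp_gradient:
  fixes R :: "real^('n::finite + 'n)^('n + 'n)"
  assumes X: "\<And>y. y \<in> Sp \<Longrightarrow> X y = sp_gradient R y" and x: "x \<in> Sp"
  shows "divergence Sp sp_metric X x = - ((2 * real CARD('n) + 1) / 2) * trace (R ** x)"
proof -
  \<comment> \<open>\<open>Q\<close> is the component of \<open>R ** x\<close> orthogonal to
    \<open>sp_algebra\<close>. The ambient derivative of the gradient and the correction in the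
    connection combine so that only \<open>Q\<close> survives, which gives the map \<open>L\<close>
    below.\<close>
  define Q where "Q = R ** x - sp_proj (R ** x)"
  define L where "L = (\<lambda>w. - (1/2) *\<^sub>R (w ** Q + x ** Q ** matrix_inv x ** w))"
  have sm: "smooth_on Sp (sp_gradient R)"
    unfolding sp_gradient_def
    by (intro smooth_on_scaleR smooth_on_add smooth_on_matrix_mult smooth_on_ident smooth_on_const)
  have vf: "vector_field_on Sp X"
    unfolding vector_field_on_def using X sm smooth_on_cong[of Sp X "sp_gradient R"] by (auto simp: sp_gradient_tangent)
  have "((\<lambda>y. - (1/2) *\<^sub>R (y ** R ** y + J_matrix ** transpose R ** J_matrix)) has_derivative
      (\<lambda>w. - (1/2) *\<^sub>R (x ** R ** w + w ** R ** x + 0))) (at x within Sp)"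
    by (intro has_derivative_scaleR_right has_derivative_add mm.FDERIV has_derivative_const
        bounded_linear.has_derivative[OF mm.bounded_linear_left] has_derivative_ident)
  then have "(X has_derivative (\<lambda>w. - (1/2) *\<^sub>R (x ** R ** w + w ** R ** x))) (at x within Sp)"
    by (intro has_derivative_transform[OF x X]) (simp_all add: sp_gradient_def[abs_def])
  note d = tangent_deriv_eq[OF this]
  have inv: "matrix_inv x ** X x = Q - R ** x"
    by (simp add: X[OF x] matrix_inv_sp_gradient[OF x] Q_def)
  have inv': "X x ** matrix_inv x = x ** Q ** matrix_inv x - x ** R"
  proof -
    have "X x = x ** (matrix_inv x ** X x)" by (simp add: Sp_inv_cancel[OF x])
    then have "X x ** matrix_inv x = x ** (Q - R ** x) ** matrix_inv x" by (simp add: inv)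
    then show ?thesis by (simp add: mm_distribs matrix_mul_assoc Sp_inv_cancel[OF x])
  qed
  have LC: "levi_civita Sp sp_metric X x w = L w" if w: "w \<in> tangent_space Sp x" for w
  proof -
    have "w ** matrix_inv x ** X x = w ** (Q - R ** x)" by (simp add: matrix_mul_assoc[symmetric] inv)
    then have wQ: "w ** Q = w ** R ** x + w ** matrix_inv x ** X x"
      by (simp add: mm_distribs matrix_mul_assoc)
    show ?thesis
      unfolding levi_civita_Sp[OF vf x w] sp_connection_def d[OF w] L_def inv' wQ
      by (simp add: mm_distribs matrix_mul_assoc algebra_simps)
  qed
  \<comment> \<open>The frame consists of the projected elementary matrices translated to
    \<open>x\<close>; its coefficient functionals read off the entries of
    \<open>x^-1 w\<close>.\<close>
  define e where "e = (\<lambda>(i,j). x ** sp_proj (axis i (axis j 1)))"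
  define \<epsilon> where "\<epsilon> = (\<lambda>(i,j) w. (matrix_inv x ** (w :: real^('n + 'n)^('n + 'n))) $ i $ j)"
  have tr: "trace_on (tangent_space Sp x) (levi_civita Sp sp_metric X x) = (\<Sum>p\<in>UNIV. \<epsilon> p (L (e p)))"
  proof (rule trace_on_frame[where L = L and e = e and \<epsilon> = \<epsilon>, OF subspace_tangent_space_Sp[OF x]])
    show "linear L"
      unfolding L_def by (auto intro!: linearI simp: mm_distribs algebra_simps)
    \<comment> \<open>Tangency is inherited from the connection instead of being computed from the
      formula for \<open>L\<close>.\<close>
    show "L w \<in> tangent_space Sp x" if w: "w \<in> tangent_space Sp x" for w
      using LC[OF w] sp_connection_tangent[OF vf x w] levi_civita_Sp[OF vf x w] by simp
    show "e p \<in> tangent_space Sp x" for p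
      by (cases p) (simp add: e_def mult_in_tangent_space_Sp[OF x] sp_proj_in)
    show "linear (\<epsilon> p)" for p
      by (cases p) (auto intro!: linearI simp: \<epsilon>_def mm_distribs)
    fix w assume w: "w \<in> tangent_space Sp x"
    define A where "A = matrix_inv x ** w"
    have "A = sp_proj A" using w by (simp add: A_def tangent_space_Sp_iff[OF x] sp_proj_id)
    also have "\<dots> = sp_proj (\<Sum>(i,j)\<in>UNIV. A $ i $ j *\<^sub>R axis i (axis j 1))"
      using matrix_eq_sum_axis[of A] by simp
    also have "\<dots> = (\<Sum>(i,j)\<in>UNIV. A $ i $ j *\<^sub>R sp_proj (axis i (axis j 1)))"
      by (simp add: linear_sum[OF linear_sp_proj] linear_cmul[OF linear_sp_proj] case_prod_unfold)
    finally have "x ** A = x ** \<dots>" by simp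
    also have "\<dots> = (\<Sum>(i,j)\<in>UNIV. A $ i $ j *\<^sub>R (x ** sp_proj (axis i (axis j 1))))"
      by (simp add: mm.sum_right mm_distribs case_prod_unfold)
    finally show "w = (\<Sum>p\<in>UNIV. \<epsilon> p w *\<^sub>R e p)"
      by (simp add: \<epsilon>_def e_def A_def Sp_inv_cancel[OF x] case_prod_unfold)
  qed (simp_all add: LC)
  have "\<epsilon> p (L (e p)) = - (1/2) * (case p of (i,j) \<Rightarrow>
      (sp_proj (axis i (axis j 1)) ** Q + Q ** sp_proj (axis i (axis j 1))) $ i $ j)" for p
  proof (cases p)
    case (Pair i j)
    let ?P = "sp_proj (axis i (axis j 1))"
    have "matrix_inv x ** L (x ** ?P) = - (1/2) *\<^sub>R (?P ** Q + Q ** ?P)"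
      by (simp add: L_def mm_distribs matrix_mul_assoc Sp_inv[OF x] Sp_inv_cancel[OF x])
    then show ?thesis by (simp add: Pair \<epsilon>_def e_def)
  qed
  then have "(\<Sum>p\<in>UNIV. \<epsilon> p (L (e p))) = - (1/2) * ((2 * real CARD('n) + 1) * trace Q)"
    by (simp only: sum_distrib_left[symmetric] trace_sp_proj_anticommutator)
  \<comment> \<open>Elements of \<open>sp_algebra\<close> have trace zero, so removing the
    projection leaves the trace unchanged.\<close>
  also have "trace Q = trace (R ** x)"
  proof -
    have "trace (J_matrix ** transpose (R ** x) ** J_matrix) = - trace (R ** x)"
      by (simp add: trace_mul_sym[of "J_matrix ** transpose (R ** x)"] J_J_left trace_uminus trace_transpose)
    then show ?thesis
      unfolding Q_def sp_proj_def by (simp add: trace_sub trace_scaleR trace_add)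
  qed
  finally show ?thesis by (simp add: divergence_def tr)
qed

section \<open>The eigenfamily\<close>

lemma trace_mult4:
  "trace (A ** X ** B ** Y) =
    (\<Sum>i\<in>UNIV. \<Sum>j\<in>UNIV. \<Sum>k\<in>UNIV. \<Sum>l\<in>UNIV. A $ i $ j * X $ j $ k * B $ k $ l * Y $ l $ i)"
  for A :: "real^'n^'n"
proof -
  have "trace (A ** X ** B ** Y) =
      (\<Sum>i\<in>UNIV. \<Sum>l\<in>UNIV. \<Sum>k\<in>UNIV. \<Sum>j\<in>UNIV. A $ i $ j * X $ j $ k * B $ k $ l * Y $ l $ i)"
    by (simp add: trace_def matrix_matrix_mult_def sum_distrib_right)
  also have "\<dots> = (\<Sum>i\<in>UNIV. \<Sum>j\<in>UNIV. \<Sum>k\<in>UNIV. \<Sum>l\<in>UNIV. A $ i $ j * X $ j $ k * B $ k $ l * Y $ l $ i)"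
    apply (rule sum.cong[OF refl])
    apply (subst sum.swap)
    apply (subst (2) sum.swap)
    apply (subst sum.swap)
    apply (rule refl)
    done
  finally show ?thesis .
qed

text \<open>The matrix \<open>a^t v\<close>. By transposition,
  \<open>trace (v^t a x^t) = trace (a^t v x)\<close>, which brings \<open>phi\<close> into the form
  \<open>trace (R x)\<close> treated above.\<close>

definition outer :: "complex^'n \<Rightarrow> complex^'n \<Rightarrow> complex^'n^'n" where
  "outer a v = (\<chi> i j. a $ i * v $ j)"

definition Re_mat :: "complex^'n^'m \<Rightarrow> real^'n^'m" where "Re_mat C = (\<chi> i j. Re (C $ i $ j))"
definition Im_mat :: "complex^'n^'m \<Rightarrow> real^'n^'m" where "Im_mat C = (\<chi> i j. Im (C $ i $ j))"

text \<open>The combination of four real traces is what \<open>cmetric\<close> forms from real and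
  imaginary gradients; it is the complex trace of the product \<open>C X D Y\<close>.\<close>

lemma complexify_trace_mult4:
  fixes C D :: "complex^'n^'n" and X Y :: "real^'n^'n"
  shows "Complex
      (trace (Re_mat C ** X ** Re_mat D ** Y) - trace (Im_mat C ** X ** Im_mat D ** Y))
      (trace (Re_mat C ** X ** Im_mat D ** Y) + trace (Im_mat C ** X ** Re_mat D ** Y)) =
    (\<Sum>i\<in>UNIV. \<Sum>j\<in>UNIV. \<Sum>k\<in>UNIV. \<Sum>l\<in>UNIV.
       C $ i $ j * complex_of_real (X $ j $ k) * D $ k $ l * complex_of_real (Y $ l $ i))"
  by (simp add: complex_eq_iff trace_mult4 Re_sum Im_sum sum_subtractf[symmetric] sum.distrib[symmetric]
      Re_mat_def Im_mat_def)
    (auto intro!: sum.cong simp: algebra_simps)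

text \<open>Rank one makes the trace factor: \<open>trace (a^t v X b^t w Y)\<close> is the product
  of the scalars \<open>v X b^t\<close> and \<open>w Y a^t\<close>.\<close>

lemma sum_outer4:
  fixes X Y :: "real^'n^'n"
  shows "(\<Sum>i\<in>UNIV. \<Sum>j\<in>UNIV. \<Sum>k\<in>UNIV. \<Sum>l\<in>UNIV.
       outer a v $ i $ j * complex_of_real (X $ j $ k) * outer b w $ k $ l * complex_of_real (Y $ l $ i))
    = (\<Sum>j\<in>UNIV. \<Sum>k\<in>UNIV. v $ j * complex_of_real (X $ j $ k) * b $ k) *
      (\<Sum>l\<in>UNIV. \<Sum>i\<in>UNIV. w $ l * complex_of_real (Y $ l $ i) * a $ i)"
proof -
  have "(\<Sum>i\<in>UNIV. \<Sum>j\<in>UNIV. \<Sum>k\<in>UNIV. \<Sum>l\<in>UNIV.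
       outer a v $ i $ j * complex_of_real (X $ j $ k) * outer b w $ k $ l * complex_of_real (Y $ l $ i))
    = (\<Sum>i\<in>UNIV. \<Sum>j\<in>UNIV. \<Sum>k\<in>UNIV. \<Sum>l\<in>UNIV.
       (v $ j * complex_of_real (X $ j $ k) * b $ k) * (w $ l * complex_of_real (Y $ l $ i) * a $ i))"
    by (simp add: outer_def mult_ac)
  also have "\<dots> = (\<Sum>i\<in>UNIV. (\<Sum>j\<in>UNIV. \<Sum>k\<in>UNIV. v $ j * complex_of_real (X $ j $ k) * b $ k) *
      (\<Sum>l\<in>UNIV. w $ l * complex_of_real (Y $ l $ i) * a $ i))"
    by (simp only: sum_distrib_left[symmetric] sum_distrib_right[symmetric])
  also have "\<dots> = (\<Sum>j\<in>UNIV. \<Sum>k\<in>UNIV. v $ j * complex_of_real (X $ j $ k) * b $ k) *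
      (\<Sum>i\<in>UNIV. \<Sum>l\<in>UNIV. w $ l * complex_of_real (Y $ l $ i) * a $ i)"
    by (simp only: sum_distrib_left[symmetric])
  also have "(\<Sum>i\<in>UNIV. \<Sum>l\<in>UNIV. w $ l * complex_of_real (Y $ l $ i) * a $ i)
      = (\<Sum>l\<in>UNIV. \<Sum>i\<in>UNIV. w $ l * complex_of_real (Y $ l $ i) * a $ i)"
    by (rule sum.swap)
  finally show ?thesis .
qed

lemma J_swap:
  fixes i j :: "'n::finite + 'n"
  shows "J_matrix $ i $ j = - (J_matrix $ j $ i)"
proof -
  have "transpose J_matrix $ j $ i = (- J_matrix) $ j $ i" by (simp only: transpose_J)
  then show ?thesis by (simp add: transpose_def)
qed

text \<open>Every vector is isotropic for the skew form \<open>v J v^t\<close>. This removes the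
  \<open>J_matrix\<close>-terms from the conformality operator.\<close>

lemma sum_J_isotropic:
  "(\<Sum>j\<in>UNIV. \<Sum>k\<in>UNIV. v $ j * complex_of_real (J_matrix $ j $ k) * v $ k) = 0"
    (is "?s = 0")
proof -
  have "?s = (\<Sum>j\<in>UNIV. \<Sum>k\<in>UNIV. v $ j * complex_of_real (- (J_matrix $ k $ j)) * v $ k)"
    by (simp only: J_swap[symmetric])
  also have "\<dots> = - (\<Sum>j\<in>UNIV. \<Sum>k\<in>UNIV. v $ j * complex_of_real (J_matrix $ k $ j) * v $ k)"
    by (simp add: sum_negf)
  also have "(\<Sum>j\<in>UNIV. \<Sum>k\<in>UNIV. v $ j * complex_of_real (J_matrix $ k $ j) * v $ k) = ?s"
    by (subst sum.swap) (simp add: mult_ac)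
  finally show ?thesis by simp
qed

section \<open>Tension and conformality of the functions \<open>phi\<close>\<close>

lemma phi_eq:
  assumes "x \<in> Sp"
  shows "phi v a x = (\<Sum>j\<in>UNIV. \<Sum>k\<in>UNIV. v $ j * complex_of_real (x $ j $ k) * a $ k)"
  using assms by (simp add: phi_def trace_def matrix_matrix_mult_def transpose_def map_matrix_def mult_ac)

lemma trace_outer_mult:
  "trace (outer a v ** map_matrix complex_of_real x) = (\<Sum>j\<in>UNIV. \<Sum>k\<in>UNIV. v $ j * complex_of_real (x $ j $ k) * a $ k)"
  by (subst sum.swap) (simp add: trace_def matrix_matrix_mult_def outer_def map_matrix_def mult_ac)

lemma Re_phi: "x \<in> Sp \<Longrightarrow> Re (phi v a x) = trace (Re_mat (outer a v) ** x)"
  and Im_phi: "x \<in> Sp \<Longrightarrow> Im (phi v a x) = trace (Im_mat (outer a v) ** x)"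
  by (simp_all add: phi_eq trace_outer_mult[symmetric] trace_def matrix_matrix_mult_def Re_mat_def
      Im_mat_def map_matrix_def)

lemma cgradient_phi:
  assumes "x \<in> Sp"
  shows "cgradient Sp sp_metric (phi v a) x =
    (sp_gradient (Re_mat (outer a v)) x, sp_gradient (Im_mat (outer a v)) x)"
  unfolding cgradient_def using assms
  by (simp add: gradient_trace[where R = "Re_mat (outer a v)"] gradient_trace[where R = "Im_mat (outer a v)"] Re_phi Im_phi)

lemma tension_phi:
  fixes v a :: "complex^('n::finite + 'n)"
  assumes x: "x \<in> Sp"
  shows "tension Sp sp_metric (phi v a) x = - ((2 * of_nat CARD('n) + 1) / 2) * phi v a x"
proof -
  have "divergence Sp sp_metric (\<lambda>y. fst (cgradient Sp sp_metric (phi v a) y)) x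
      = - ((2 * real CARD('n) + 1) / 2) * Re (phi v a x)"
    unfolding Re_phi[OF x] by (rule divergence_sp_gradient[OF _ x]) (simp add: cgradient_phi)
  moreover have "divergence Sp sp_metric (\<lambda>y. snd (cgradient Sp sp_metric (phi v a) y)) x
      = - ((2 * real CARD('n) + 1) / 2) * Im (phi v a x)"
    unfolding Im_phi[OF x] by (rule divergence_sp_gradient[OF _ x]) (simp add: cgradient_phi)
  ultimately show ?thesis
    by (simp add: tension_def cdivergence_def complex_eq_iff)
qed

lemma sp_metric_gradients:
  assumes x: "x \<in> Sp"
  shows "sp_metric x (sp_gradient R x) (sp_gradient S x)
    = - (1/2) * (trace (R ** x ** S ** x) + trace (R ** J_matrix ** transpose S ** J_matrix))"
proof -
  have "sp_metric x (sp_gradient R x) (sp_gradient S x) = trace (R ** sp_gradient S x)"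
    by (rule sp_metric_sp_gradient[OF x sp_gradient_tangent[OF x]])
  also have "R ** sp_gradient S x
      = - (1/2) *\<^sub>R (R ** x ** S ** x + R ** J_matrix ** transpose S ** J_matrix)"
    unfolding sp_gradient_def by (simp add: mm_distribs matrix_mul_assoc)
  finally show ?thesis by (simp add: trace_scaleR trace_uminus trace_add)
qed

lemma conformality_phi:
  assumes x: "x \<in> Sp"
  shows "conformality Sp sp_metric (phi v a) (phi v b) x = - (1/2) * phi v a x * phi v b x"
proof -
  \<comment> \<open>Transposition turns \<open>b^t v\<close> into \<open>v^t b\<close>, so in the
    \<open>J_matrix\<close>-terms the two copies of \<open>v\<close> meet and produce the factor
    \<open>v J v^t = 0\<close>.\<close>
  have t: "transpose (Re_mat (outer b v)) = Re_mat (outer v b)"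
    "transpose (Im_mat (outer b v)) = Im_mat (outer v b)"
    by (simp_all add: vec_eq_iff transpose_def Re_mat_def Im_mat_def outer_def mult.commute)
  have "conformality Sp sp_metric (phi v a) (phi v b) x = - (1/2) *
     (Complex
      (trace (Re_mat (outer a v) ** x ** Re_mat (outer b v) ** x) - trace (Im_mat (outer a v) ** x ** Im_mat (outer b v) ** x))
      (trace (Re_mat (outer a v) ** x ** Im_mat (outer b v) ** x) + trace (Im_mat (outer a v) ** x ** Re_mat (outer b v) ** x))
     + Complex
      (trace (Re_mat (outer a v) ** J_matrix ** Re_mat (outer v b) ** J_matrix) - trace (Im_mat (outer a v) ** J_matrix ** Im_mat (outer v b) ** J_matrix))
      (trace (Re_mat (outer a v) ** J_matrix ** Im_mat (outer v b) ** J_matrix) + trace (Im_mat (outer a v) ** J_matrix ** Re_mat (outer v b) ** J_matrix)))"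
    by (simp add: conformality_def cgradient_phi[OF x] cmetric_def sp_metric_gradients[OF x] t
        complex_eq_iff field_simps)
  also have "\<dots> = - (1/2) * (phi v b x * phi v a x)"
    unfolding complexify_trace_mult4 sum_outer4 sum_J_isotropic phi_eq[OF x] by simp
  finally show ?thesis by simp
qed

section \<open>Linearity of \<open>phi\<close> and the dimension of the family\<close>

lemma phi_add: "phi v (a + b) = phi v a + phi v b"
proof
  fix x show "phi v (a + b) x = (phi v a + phi v b) x"
    by (cases "x \<in> Sp") (simp_all add: phi_eq algebra_simps sum.distrib, simp_all add: phi_def)
qed

lemma phi_scale: "phi v (c *s a) = cfun_scale c (phi v a)"
  unfolding fun_eq_iff cfun_scale_def
proof
  fix x show "phi v (c *s a) x = c * phi v a x"
    by (cases "x \<in> Sp") (simp_all add: phi_eq sum_distrib_left mult_ac, simp_all add: phi_def)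
qed

lemma mat_1_in_Sp: "mat 1 \<in> Sp"
  by (simp add: Sp_def transpose_mat)

text \<open>The zero function is represented by both \<open>R\<close> and 0, so the gradient formula
  at the identity forces the projection of \<open>R\<close> to \<open>sp_algebra\<close> to
  vanish.\<close>

lemma trace_zero_on_Sp:
  assumes "\<And>y. y \<in> Sp \<Longrightarrow> trace (R ** y) = 0"
  shows "R ** J_matrix = J_matrix ** transpose R"
proof -
  have "sp_gradient R (mat 1) = gradient Sp sp_metric (\<lambda>y. 0) (mat 1)"
    by (rule gradient_trace[symmetric, OF _ mat_1_in_Sp]) (simp add: assms)
  also have "\<dots> = sp_gradient 0 (mat 1)"
    by (rule gradient_trace[OF _ mat_1_in_Sp]) (simp add: mm_distribs trace_0[unfolded mat_0])
  also have "\<dots> = 0"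
    by (simp add: sp_gradient_def mm_distribs transpose_def vec_eq_iff matrix_matrix_mult_def)
  finally have "R + J_matrix ** transpose R ** J_matrix = 0"
    by (simp add: sp_gradient_def)
  then have "(R + J_matrix ** transpose R ** J_matrix) ** J_matrix = 0"
    by (simp add: mm_distribs)
  then show ?thesis by (simp add: mm_distribs J_J_right)
qed

text \<open>Put \<open>w = v J\<close>. The real and imaginary parts of
  \<open>trace_zero_on_Sp\<close> together say that the rank-one matrix \<open>a^t w\<close> is
  skew. Since \<open>w\<close> is non-zero, the diagonal entry at an index with
  \<open>w $ i \<noteq> 0\<close> gives \<open>a $ i = 0\<close>, and row \<open>i\<close> then
  gives the remaining entries of \<open>a\<close>.\<close>

lemma phi_eq_0D:
  fixes v :: "complex^('n::finite + 'n)"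
  assumes v: "v \<noteq> 0" and z: "phi v a = 0"
  shows "a = 0"
proof -
  define w where "w = (\<chi> m. \<Sum>j\<in>UNIV. v $ j * complex_of_real (J_matrix $ j $ m))"
  have z': "phi v a y = 0" for y using z by simp
  have R: "Re_mat (outer a v) ** J_matrix = J_matrix ** transpose (Re_mat (outer a v))"
    by (rule trace_zero_on_Sp) (metis Re_phi z' zero_complex.sel(1))
  have I: "Im_mat (outer a v) ** J_matrix = J_matrix ** transpose (Im_mat (outer a v))"
    by (rule trace_zero_on_Sp) (metis Im_phi z' zero_complex.sel(2))
  have e: "a $ i * w $ m = - (a $ m * w $ i)" for i m
  proof -
    have "(\<Sum>j\<in>UNIV. outer a v $ i $ j * complex_of_real (J_matrix $ j $ m))
        = (\<Sum>k\<in>UNIV. complex_of_real (J_matrix $ i $ k) * outer a v $ m $ k)"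
      using R I
      by (simp add: complex_eq_iff vec_eq_iff matrix_matrix_mult_def Re_mat_def Im_mat_def transpose_def)
    then show ?thesis
      unfolding J_swap[of i] by (simp add: w_def outer_def sum_distrib_left sum_negf mult_ac)
  qed
  have "w $ Inr b = v $ Inl b" "w $ Inl b = - v $ Inr b" for b
    by (simp_all add: w_def UNIV_Plus_UNIV[symmetric] sum.Plus J_nth
        if_distrib if_distribR eq_commute cong: if_cong del: UNIV_Plus_UNIV)
  then have "w \<noteq> 0" using v by (metis (no_types, lifting) neg_equal_0_iff_equal old.sum.exhaust vec_eq_iff zero_index)
  then obtain i where i: "w $ i \<noteq> 0" by (auto simp: vec_eq_iff)
  have "a $ i = 0" using e[of i i] i by simp
  then have "a $ m = 0" for m using e[of i m] i by simp
  then show ?thesis by (simp add: vec_eq_iff)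
qed

lemma phi_linear: "Vector_Spaces.linear (*s) cfun_scale (phi v)"
  by unfold_locales (simp_all add: phi_add phi_scale)

lemma smooth_on_phi: "smooth_on Sp (phi v a)"
proof -
  have l: "bounded_linear (\<lambda>x::real^('a + 'a)^('a + 'a). \<Sum>j\<in>UNIV. \<Sum>k\<in>UNIV. v $ j * complex_of_real (x $ j $ k) * a $ k)"
    unfolding linear_conv_bounded_linear[symmetric]
    by (auto intro!: linearI simp: algebra_simps sum.distrib scaleR_conv_of_real[where 'a = complex] sum_distrib_left)
  show ?thesis
    by (rule iffD2[OF smooth_on_cong[OF phi_eq] smooth_on_bounded_linear[OF l]])
qed

theorem theorem13p1:
  fixes v :: "complex^('n::finite + 'n)"
  assumes "v \<noteq> 0"
  shows "cfun.subspace (E_family v) \<and> cfun.dim (E_family v) = 2 * CARD('n) \<and>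
    eigenfamily Sp sp_metric (E_family v) \<and>
    (\<forall>\<phi>\<in>E_family v. \<forall>\<psi>\<in>E_family v. \<forall>x\<in>Sp.
       tension Sp sp_metric \<phi> x = - ((2 * of_nat CARD('n) + 1) / 2) * \<phi> x \<and>
       conformality Sp sp_metric \<phi> \<psi> x = - (1 / 2) * \<phi> x * \<psi> x)"
proof (intro conjI)
  have E: "E_family v = phi v ` UNIV" by (auto simp: E_family_def)
  \<comment> \<open>Only the domain is finite-dimensional; the ambient space of all complex
    functions on matrices is not. The dimension of the family comes from injectivity of
    \<open>phi v\<close>.\<close>
  interpret pair: finite_dimensional_vector_space_pair_1
    "(*s) :: complex \<Rightarrow> complex^('n + 'n) \<Rightarrow> _" cart_basis cfun_scale
    by unfold_locales
  interpret l: Vector_Spaces.linear "(*s)" cfun_scale "phi v" by (rule phi_linear)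
  show "cfun.subspace (E_family v)"
    unfolding E by (rule l.subspace_image) (rule vec.subspace_UNIV)
  have "inj (phi v)"
    using phi_eq_0D[OF assms] by (auto simp: l.inj_iff_eq_0)
  then have "cfun.dim (phi v ` UNIV) = vec.dim (UNIV :: (complex^('n + 'n)) set)"
    by (intro pair.dim_image_eq phi_linear) (simp add: vec.span_UNIV)
  also have "\<dots> = CARD('n + 'n)" by (rule vec_dim_card)
  finally show "cfun.dim (E_family v) = 2 * CARD('n)"
    unfolding E by simp
  show main: "\<forall>\<phi>\<in>E_family v. \<forall>\<psi>\<in>E_family v. \<forall>x\<in>Sp.
       tension Sp sp_metric \<phi> x = - ((2 * of_nat CARD('n) + 1) / 2) * \<phi> x \<and>
       conformality Sp sp_metric \<phi> \<psi> x = - (1 / 2) * \<phi> x * \<psi> x"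
    unfolding E using tension_phi conformality_phi by blast
  show "eigenfamily Sp sp_metric (E_family v)"
    unfolding eigenfamily_def
  proof (intro conjI exI)
    show "\<forall>\<phi>\<in>E_family v. smooth_on Sp \<phi>" unfolding E by (simp add: smooth_on_phi)
  qed (rule main)
qed

end
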